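(* Let $(W,\cdot,\iota)$ be any constraint domain. Let $\Gamma$ be a set and $\Delta$ a multiset of HyLL judgements, and $C@w$ a judgement, such that $\Gamma;\Delta\Rightarrow C@w$ is derivable in the (unfocused) HyLL sequent calculus. Let $\Gamma^-$ be obtained by replacing each $A@u\in\Gamma$ by $A^-@u$ for some negative polarization $A^-$ of $A$, let $C^-$ be a negative polarization of $C$, and let $\Delta^+$ be obtained by replacing each $A@u\in\Delta$ by $A^+@u$ for some positive polarization $A^+$ of $A$. Write $!\Gamma^-$ for the collection of judgements $!N@u$ with $N@u\in\Gamma^-$. Then the active sequent $\cdot;\cdot;\ !\Gamma^-,\Delta^+\Rightarrow C^-@w;\cdot$ is derivable in the focused HyLL calculus.
   Context: HyLL: worlds are elements of a monoid $(W,\cdot,\iota)$ (world expressions built from world variables and $\cdot$, up to monoid equations); terms are first-order; world and term variables never mix; $\alpha$ ranges over variables of either kind, $\tau$ over terms/worlds, $[\tau/\alpha]$ is capture-avoiding substitution. Unpolarized HyLL propositions: $A ::= a\,\vec t\mid A\otimes B\mid\mathbf1\mid A\multimap B\mid A\&B\mid\top\mid A\oplus B\mid\mathbf0\mid !A\mid\forall\alpha.A\mid\exists\alpha.A\mid(A\ \mathsf{at}\ w)\mid\downarrow u.A$; the unfocused HyLL sequent calculus has sequents $\Gamma;\Delta\Rightarrow C@w$ ($\Gamma$ a set, $\Delta$ a multiset of judgements $A@u$) with the standard intuitionistic linear rules (init on atoms at the same world, copy from $\Gamma$ to $\Delta$, left/right rules for each connective, with left rules acting on a hypothesis $A@u$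 at its own world $u$ and right rules keeping the succedent world $w$, and $!$R requiring empty $\Delta$), plus $\mathsf{at}$R: from $\Gamma;\Delta\Rightarrow A@u$ infer $\Gamma;\Delta\Rightarrow(A\ \mathsf{at}\ u)@v$; $\mathsf{at}$L: from $\Gamma;\Delta,A@u\Rightarrow C@w$ infer $\Gamma;\Delta,(A\ \mathsf{at}\ u)@v\Rightarrow C@w$; $\downarrow$R: from $\Gamma;\Delta\Rightarrow[w/u]A@w$ infer $\Gamma;\Delta\Rightarrow\downarrow u.A@w$; $\downarrow$L: from $\Gamma;\Delta,[v/u]A@v\Rightarrow C@w$ infer $\Gamma;\Delta,\downarrow u.A@v\Rightarrow C@w$. Polarized syntax: atomic predicates are each assigned a polarity, positive atoms $p\,\vec t$ and negative atoms $n\,\vec t$. Positive $P,Q ::= p\,\vec t\mid P\otimes Q\mid\mathbf1\mid P\oplus Q\mid\mathbf0\mid !N\mid\exists\alpha.P\mid\downarrow u.P\mid(P\ \mathsf{at}\ w)\mid\mathsf{pos}\,N$; negative $N,M ::= n\,\vec t\mid N\&M\mid\top\mid P\multimap N\mid\forall\alpha.N\mid\downarrow u.N\mid(N\ \mathsf{at}\ w)\mid\mathsf{neg}\,P$. A positive (resp. negative) polarization of $A$ is a positive (resp. negative) polarized proposition that becomes $A$ when all shifts $\mathsf{pos},\mathsf{neg}$ are deleted. Focused sequents: active $\Gamma;\Delta;\Omega\Rightarrow\cdot;P@w$ and $\Gamma;\Delta;\Omega\Rightarrow N@w;\cdot$; left-focused $\Gamma;\Delta;[N@u]\Rightarrow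 P@w$; right-focused $\Gamma;\Delta\Rightarrow[P@w]$. $\Gamma$ (set), $\Delta$ (multiset) contain negative judgements; $\Omega$ (multiset) positive judgements. Below $\mathcal L$ denotes $\Gamma;\Delta;\Omega$ and $\mathcal R$ denotes either $\cdot;Q@w$ or $N@w;\cdot$; "$X\Longrightarrow Y$" means premises $X$ give conclusion $Y$. Focused rules: li: $\Gamma;\cdot;[n\,\vec t@w]\Rightarrow\mathsf{pos}(n\,\vec t)@w$. $\mathsf{neg}$L: $\Gamma;\Delta;P@u\Rightarrow\cdot;Q@w\Longrightarrow\Gamma;\Delta;[\mathsf{neg}P@u]\Rightarrow Q@w$. $\mathsf{pos}$R: $\Gamma;\Delta;\cdot\Rightarrow N@w;\cdot\Longrightarrow\Gamma;\Delta\Rightarrow[\mathsf{pos}N@w]$. $\&$L$_i$: $\Gamma;\Delta;[N_i@u]\Rightarrow Q@w\Longrightarrow\Gamma;\Delta;[N_1\&N_2@u]\Rightarrow Q@w$. $\multimap$L: $\Gamma;\Delta\Rightarrow[P@u]$ and $\Gamma;\Xi;[N@u]\Rightarrow Q@w\Longrightarrow\Gamma;\Delta,\Xi;[P\multimap N@u]\Rightarrow Q@w$. $\forall$L: $\Gamma;\Delta;[[\tau/\alpha]N@u]\Rightarrow Q@w\Longrightarrow\Gamma;\Delta;[\forall\alpha.N@u]\Rightarrow Q@w$. $\downarrow$LF: $\Gamma;\Delta;[[v/u]N@v]\Rightarrow Q@w\Longrightarrow\Gamma;\Delta;[\downarrow u.N@v]\Rightarrow Q@w$. $\mathsf{at}$LF: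 $\Gamma;\Delta;[N@u]\Rightarrow Q@w\Longrightarrow\Gamma;\Delta;[(N\ \mathsf{at}\ u)@v]\Rightarrow Q@w$. ri: $\Gamma;\mathsf{neg}(p\,\vec t)@w\Rightarrow[p\,\vec t@w]$. $\otimes$R: $\Gamma;\Delta\Rightarrow[P@w]$ and $\Gamma;\Xi\Rightarrow[Q@w]\Longrightarrow\Gamma;\Delta,\Xi\Rightarrow[P\otimes Q@w]$. $\oplus$R$_i$: $\Gamma;\Delta\Rightarrow[P_i@w]\Longrightarrow\Gamma;\Delta\Rightarrow[P_1\oplus P_2@w]$. $\exists$R: $\Gamma;\Delta\Rightarrow[[\tau/\alpha]P@w]\Longrightarrow\Gamma;\Delta\Rightarrow[\exists\alpha.P@w]$. $!$R: $\Gamma;\cdot;\cdot\Rightarrow N@w;\cdot\Longrightarrow\Gamma;\cdot\Rightarrow[!N@w]$. $\downarrow$RF: $\Gamma;\Delta\Rightarrow[[w/u]P@w]\Longrightarrow\Gamma;\Delta\Rightarrow[\downarrow u.P@w]$. $\mathsf{at}$RF: $\Gamma;\Delta\Rightarrow[P@u]\Longrightarrow\Gamma;\Delta\Rightarrow[(P\ \mathsf{at}\ u)@w]$. $\mathbf1$R: $\Gamma;\cdot\Rightarrow[\mathbf1@w]$. Active rules: $\otimes$L: $\mathcal L,P@u,Q@u\Rightarrow\mathcal R\Longrightarrow\mathcal L,P\otimes Q@u\Rightarrow\mathcal R$. $\mathbf1$L: $\mathcal L\Rightarrow\mathcal R\Longrightarrow\mathcal L,\mathbf1@u\Rightarrow\mathcal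 R$. $\oplus$L: $\mathcal L,P@u\Rightarrow\mathcal R$ and $\mathcal L,Q@u\Rightarrow\mathcal R\Longrightarrow\mathcal L,P\oplus Q@u\Rightarrow\mathcal R$. $\downarrow$LA: $\mathcal L,[v/u]P@v\Rightarrow\mathcal R\Longrightarrow\mathcal L,\downarrow u.P@v\Rightarrow\mathcal R$. $\mathsf{at}$LA: $\mathcal L,P@u\Rightarrow\mathcal R\Longrightarrow\mathcal L,(P\ \mathsf{at}\ u)@v\Rightarrow\mathcal R$. $\exists$L: $\mathcal L,P@u\Rightarrow\mathcal R\Longrightarrow\mathcal L,\exists\alpha.P@u\Rightarrow\mathcal R$ ($\alpha$ fresh). $!$L: $\Gamma,N@u;\Delta;\Omega\Rightarrow\mathcal R\Longrightarrow\Gamma;\Delta;\Omega,!N@u\Rightarrow\mathcal R$. $\mathsf{pos}$L: $\Gamma;\Delta,N@w;\Omega\Rightarrow\mathcal R\Longrightarrow\Gamma;\Delta;\Omega,\mathsf{pos}N@w\Rightarrow\mathcal R$. lp: $\Gamma;\Delta,\mathsf{neg}(p\,\vec t)@w;\Omega\Rightarrow\mathcal R\Longrightarrow\Gamma;\Delta;\Omega,p\,\vec t@w\Rightarrow\mathcal R$. $\mathbf0$L: $\mathcal L,\mathbf0@u\Rightarrow\mathcal R$. $\&$R: $\mathcal L\Rightarrow M@w;\cdot$ and $\mathcal L\Rightarrow N@w;\cdot\Longrightarrow\mathcal L\Rightarrow M\&N@w;\cdot$. $\top$R: $\mathcal L\Rightarrow\top@w;\cdot$. $\multimap$R: $\mathcal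 L,P@w\Rightarrow N@w;\cdot\Longrightarrow\mathcal L\Rightarrow P\multimap N@w;\cdot$. $\downarrow$RA: $\mathcal L\Rightarrow[w/u]N@w;\cdot\Longrightarrow\mathcal L\Rightarrow\downarrow u.N@w;\cdot$. $\mathsf{at}$RA: $\mathcal L\Rightarrow N@u;\cdot\Longrightarrow\mathcal L\Rightarrow(N\ \mathsf{at}\ u)@w;\cdot$. $\forall$R: $\mathcal L\Rightarrow N@u;\cdot\Longrightarrow\mathcal L\Rightarrow\forall\alpha.N@u;\cdot$ ($\alpha$ fresh). $\mathsf{neg}$R: $\mathcal L\Rightarrow\cdot;P@w\Longrightarrow\mathcal L\Rightarrow\mathsf{neg}P@w;\cdot$. rp: $\mathcal L\Rightarrow\cdot;\mathsf{pos}(n\,\vec t)@w\Longrightarrow\mathcal L\Rightarrow n\,\vec t@w;\cdot$. Decisions: lf: $\Gamma;\Delta;[N@u]\Rightarrow Q@w\Longrightarrow\Gamma;\Delta,N@u;\cdot\Rightarrow\cdot;Q@w$, provided $N$ is not of the form $\mathsf{neg}(p\,\vec t)$. cplf: $\Gamma,N@u;\Delta;[N@u]\Rightarrow Q@w\Longrightarrow\Gamma,N@u;\Delta;\cdot\Rightarrow\cdot;Q@w$. rf: $\Gamma;\Delta\Rightarrow[P@w]\Longrightarrow\Gamma;\Delta;\cdot\Rightarrow\cdot;P@w$, provided $P$ is not of the form $\mathsf{pos}(n\,\vec t)$. *)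

theory Defs
  imports Main "HOL-Library.Multiset"
begin

text \<open>First-order terms over function symbols of type 'f.  Free variables are
  names (nat), bound variables are de Bruijn indices counting only enclosing
  term binders.\<close>
datatype 'f tm = TFree nat | TBnd nat | TFn 'f "'f tm list"

primrec tm_open :: "nat \<Rightarrow> 'f tm \<Rightarrow> 'f tm \<Rightarrow> 'f tm" where
  "tm_open k t (TFree x) = TFree x"
| "tm_open k t (TBnd i) = (if i = k then t else TBnd i)"
| "tm_open k t (TFn f ts) = TFn f (map (tm_open k t) ts)"

primrec tm_fv :: "'f tm \<Rightarrow> nat set" where
  "tm_fv (TFree x) = {x}"
| "tm_fv (TBnd i) = {}"
| "tm_fv (TFn f ts) = \<Union> (set (map tm_fv ts))"

primrec tm_lc :: "'f tm \<Rightarrow> bool" where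
  "tm_lc (TFree x) = True"
| "tm_lc (TBnd i) = False"
| "tm_lc (TFn f ts) = list_all tm_lc ts"

datatype 'c wexp = WConst 'c | WUnit | WMul "'c wexp" "'c wexp" | WFree nat | WBnd nat

primrec w_open :: "nat \<Rightarrow> 'c wexp \<Rightarrow> 'c wexp \<Rightarrow> 'c wexp" where
  "w_open k v (WConst c) = WConst c"
| "w_open k v WUnit = WUnit"
| "w_open k v (WMul a b) = WMul (w_open k v a) (w_open k v b)"
| "w_open k v (WFree x) = WFree x"
| "w_open k v (WBnd i) = (if i = k then v else WBnd i)"

primrec w_fv :: "'c wexp \<Rightarrow> nat set" where
  "w_fv (WConst c) = {}"
| "w_fv WUnit = {}"
| "w_fv (WMul a b) = w_fv a \<union> w_fv b"
| "w_fv (WFree x) = {x}"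
| "w_fv (WBnd i) = {}"

primrec w_lc :: "'c wexp \<Rightarrow> bool" where
  "w_lc (WConst c) = True"
| "w_lc WUnit = True"
| "w_lc (WMul a b) = (w_lc a \<and> w_lc b)"
| "w_lc (WFree x) = True"
| "w_lc (WBnd i) = False"

inductive weq :: "('c::monoid_mult) wexp \<Rightarrow> 'c wexp \<Rightarrow> bool" where
  weq_refl: "weq u u"
| weq_sym: "weq u v \<Longrightarrow> weq v u"
| weq_trans: "weq u v \<Longrightarrow> weq v w \<Longrightarrow> weq u w"
| weq_cong: "weq u u' \<Longrightarrow> weq v v' \<Longrightarrow> weq (WMul u v) (WMul u' v')"
| weq_assoc: "weq (WMul (WMul u v) w) (WMul u (WMul v w))"
| weq_unitl: "weq (WMul WUnit u) u"
| weq_unitr: "weq (WMul u WUnit) u"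
| weq_const: "weq (WMul (WConst c) (WConst d)) (WConst (c * d))"
| weq_one: "weq (WConst 1) WUnit"

datatype sort = STm | SWd

datatype ('a, 'f, 'c) hprop =
    HAtom 'a "'f tm list"
  | HTensor "('a, 'f, 'c) hprop" "('a, 'f, 'c) hprop"
  | HOne
  | HLolli "('a, 'f, 'c) hprop" "('a, 'f, 'c) hprop"
  | HWith "('a, 'f, 'c) hprop" "('a, 'f, 'c) hprop"
  | HTop
  | HPlus "('a, 'f, 'c) hprop" "('a, 'f, 'c) hprop"
  | HZero
  | HBang "('a, 'f, 'c) hprop"
  | HAll sort "('a, 'f, 'c) hprop"
  | HEx sort "('a, 'f, 'c) hprop"
  | HAt "('a, 'f, 'c) hprop" "'c wexp"
  | HDown "('a, 'f, 'c) hprop"   \<comment> \<open>\<down>u.A, binds a world variable\<close>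

primrec h_openT :: "nat \<Rightarrow> 'f tm \<Rightarrow> ('a, 'f, 'c) hprop \<Rightarrow> ('a, 'f, 'c) hprop" where
  "h_openT k t (HAtom a ts) = HAtom a (map (tm_open k t) ts)"
| "h_openT k t (HTensor A B) = HTensor (h_openT k t A) (h_openT k t B)"
| "h_openT k t HOne = HOne"
| "h_openT k t (HLolli A B) = HLolli (h_openT k t A) (h_openT k t B)"
| "h_openT k t (HWith A B) = HWith (h_openT k t A) (h_openT k t B)"
| "h_openT k t HTop = HTop"
| "h_openT k t (HPlus A B) = HPlus (h_openT k t A) (h_openT k t B)"
| "h_openT k t HZero = HZero"
| "h_openT k t (HBang A) = HBang (h_openT k t A)"
| "h_openT k t (HAll s A) = HAll s (h_openT (if s = STm then Suc k else k) t A)"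
| "h_openT k t (HEx s A) = HEx s (h_openT (if s = STm then Suc k else k) t A)"
| "h_openT k t (HAt A w) = HAt (h_openT k t A) w"
| "h_openT k t (HDown A) = HDown (h_openT k t A)"

primrec h_openW :: "nat \<Rightarrow> 'c wexp \<Rightarrow> ('a, 'f, 'c) hprop \<Rightarrow> ('a, 'f, 'c) hprop" where
  "h_openW k v (HAtom a ts) = HAtom a ts"
| "h_openW k v (HTensor A B) = HTensor (h_openW k v A) (h_openW k v B)"
| "h_openW k v HOne = HOne"
| "h_openW k v (HLolli A B) = HLolli (h_openW k v A) (h_openW k v B)"
| "h_openW k v (HWith A B) = HWith (h_openW k v A) (h_openW k v B)"
| "h_openW k v HTop = HTop"
| "h_openW k v (HPlus A B) = HPlus (h_openW k v A) (h_openW k v B)"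
| "h_openW k v HZero = HZero"
| "h_openW k v (HBang A) = HBang (h_openW k v A)"
| "h_openW k v (HAll s A) = HAll s (h_openW (if s = SWd then Suc k else k) v A)"
| "h_openW k v (HEx s A) = HEx s (h_openW (if s = SWd then Suc k else k) v A)"
| "h_openW k v (HAt A w) = HAt (h_openW k v A) (w_open k v w)"
| "h_openW k v (HDown A) = HDown (h_openW (Suc k) v A)"

primrec h_fvT :: "('a, 'f, 'c) hprop \<Rightarrow> nat set" where
  "h_fvT (HAtom a ts) = \<Union> (set (map tm_fv ts))"
| "h_fvT (HTensor A B) = h_fvT A \<union> h_fvT B"
| "h_fvT HOne = {}"
| "h_fvT (HLolli A B) = h_fvT A \<union> h_fvT B"
| "h_fvT (HWith A B) = h_fvT A \<union> h_fvT B"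
| "h_fvT HTop = {}"
| "h_fvT (HPlus A B) = h_fvT A \<union> h_fvT B"
| "h_fvT HZero = {}"
| "h_fvT (HBang A) = h_fvT A"
| "h_fvT (HAll s A) = h_fvT A"
| "h_fvT (HEx s A) = h_fvT A"
| "h_fvT (HAt A w) = h_fvT A"
| "h_fvT (HDown A) = h_fvT A"

primrec h_fvW :: "('a, 'f, 'c) hprop \<Rightarrow> nat set" where
  "h_fvW (HAtom a ts) = {}"
| "h_fvW (HTensor A B) = h_fvW A \<union> h_fvW B"
| "h_fvW HOne = {}"
| "h_fvW (HLolli A B) = h_fvW A \<union> h_fvW B"
| "h_fvW (HWith A B) = h_fvW A \<union> h_fvW B"
| "h_fvW HTop = {}"
| "h_fvW (HPlus A B) = h_fvW A \<union> h_fvW B"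
| "h_fvW HZero = {}"
| "h_fvW (HBang A) = h_fvW A"
| "h_fvW (HAll s A) = h_fvW A"
| "h_fvW (HEx s A) = h_fvW A"
| "h_fvW (HAt A w) = h_fvW A \<union> w_fv w"
| "h_fvW (HDown A) = h_fvW A"

type_synonym ('a, 'f, 'c) hjdg = "('a, 'f, 'c) hprop \<times> 'c wexp"

definition hctx_fvT :: "('a, 'f, 'c) hjdg set \<Rightarrow> nat set" where
  "hctx_fvT S = (\<Union>(A, u)\<in>S. h_fvT A)"

definition hctx_fvW :: "('a, 'f, 'c) hjdg set \<Rightarrow> nat set" where
  "hctx_fvW S = (\<Union>(A, u)\<in>S. h_fvW A \<union> w_fv u)"

inductive useq :: "('a, 'f, 'c::monoid_mult) hjdg set \<Rightarrow> ('a, 'f, 'c) hjdg multiset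
                    \<Rightarrow> ('a, 'f, 'c) hprop \<Rightarrow> 'c wexp \<Rightarrow> bool" where
  u_init: "weq u w \<Longrightarrow> useq \<Gamma> {#(HAtom a ts, u)#} (HAtom a ts) w"
| u_copy: "(A, u) \<in> \<Gamma> \<Longrightarrow> useq \<Gamma> (add_mset (A, u) \<Delta>) C w \<Longrightarrow> useq \<Gamma> \<Delta> C w"
| u_tensorR: "useq \<Gamma> \<Delta>1 A w \<Longrightarrow> useq \<Gamma> \<Delta>2 B w \<Longrightarrow> useq \<Gamma> (\<Delta>1 + \<Delta>2) (HTensor A B) w"
| u_tensorL: "useq \<Gamma> (add_mset (A, u) (add_mset (B, u) \<Delta>)) C w
              \<Longrightarrow> useq \<Gamma> (add_mset (HTensor A B, u) \<Delta>) C w"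
| u_oneR: "useq \<Gamma> {#} HOne w"
| u_oneL: "useq \<Gamma> \<Delta> C w \<Longrightarrow> useq \<Gamma> (add_mset (HOne, u) \<Delta>) C w"
| u_lolliR: "useq \<Gamma> (add_mset (A, w) \<Delta>) B w \<Longrightarrow> useq \<Gamma> \<Delta> (HLolli A B) w"
| u_lolliL: "useq \<Gamma> \<Delta>1 A u \<Longrightarrow> useq \<Gamma> (add_mset (B, u) \<Delta>2) C w
              \<Longrightarrow> useq \<Gamma> (add_mset (HLolli A B, u) (\<Delta>1 + \<Delta>2)) C w"
| u_withR: "useq \<Gamma> \<Delta> A w \<Longrightarrow> useq \<Gamma> \<Delta> B w \<Longrightarrow> useq \<Gamma> \<Delta> (HWith A B) w"
| u_withL1: "useq \<Gamma> (add_mset (A, u) \<Delta>) C w \<Longrightarrow> useq \<Gamma> (add_mset (HWith A B, u) \<Delta>) C w"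
| u_withL2: "useq \<Gamma> (add_mset (B, u) \<Delta>) C w \<Longrightarrow> useq \<Gamma> (add_mset (HWith A B, u) \<Delta>) C w"
| u_topR: "useq \<Gamma> \<Delta> HTop w"
| u_plusR1: "useq \<Gamma> \<Delta> A w \<Longrightarrow> useq \<Gamma> \<Delta> (HPlus A B) w"
| u_plusR2: "useq \<Gamma> \<Delta> B w \<Longrightarrow> useq \<Gamma> \<Delta> (HPlus A B) w"
| u_plusL: "useq \<Gamma> (add_mset (A, u) \<Delta>) C w \<Longrightarrow> useq \<Gamma> (add_mset (B, u) \<Delta>) C w
              \<Longrightarrow> useq \<Gamma> (add_mset (HPlus A B, u) \<Delta>) C w"
| u_zeroL: "useq \<Gamma> (add_mset (HZero, u) \<Delta>) C w"
| u_bangR: "useq \<Gamma> {#} A w \<Longrightarrow> useq \<Gamma> {#} (HBang A) w"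
| u_bangL: "useq (insert (A, u) \<Gamma>) \<Delta> C w \<Longrightarrow> useq \<Gamma> (add_mset (HBang A, u) \<Delta>) C w"
| u_allR_tm: "x \<notin> hctx_fvT (\<Gamma> \<union> set_mset \<Delta>) \<union> h_fvT A
              \<Longrightarrow> useq \<Gamma> \<Delta> (h_openT 0 (TFree x) A) w \<Longrightarrow> useq \<Gamma> \<Delta> (HAll STm A) w"
| u_allR_wd: "x \<notin> hctx_fvW (\<Gamma> \<union> set_mset \<Delta>) \<union> h_fvW A \<union> w_fv w
              \<Longrightarrow> useq \<Gamma> \<Delta> (h_openW 0 (WFree x) A) w \<Longrightarrow> useq \<Gamma> \<Delta> (HAll SWd A) w"
| u_allL_tm: "tm_lc t \<Longrightarrow> useq \<Gamma> (add_mset (h_openT 0 t A, u) \<Delta>) C w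
              \<Longrightarrow> useq \<Gamma> (add_mset (HAll STm A, u) \<Delta>) C w"
| u_allL_wd: "w_lc v \<Longrightarrow> useq \<Gamma> (add_mset (h_openW 0 v A, u) \<Delta>) C w
              \<Longrightarrow> useq \<Gamma> (add_mset (HAll SWd A, u) \<Delta>) C w"
| u_exR_tm: "tm_lc t \<Longrightarrow> useq \<Gamma> \<Delta> (h_openT 0 t A) w \<Longrightarrow> useq \<Gamma> \<Delta> (HEx STm A) w"
| u_exR_wd: "w_lc v \<Longrightarrow> useq \<Gamma> \<Delta> (h_openW 0 v A) w \<Longrightarrow> useq \<Gamma> \<Delta> (HEx SWd A) w"
| u_exL_tm: "x \<notin> hctx_fvT (\<Gamma> \<union> set_mset \<Delta>) \<union> h_fvT A \<union> h_fvT C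
              \<Longrightarrow> useq \<Gamma> (add_mset (h_openT 0 (TFree x) A, u) \<Delta>) C w
              \<Longrightarrow> useq \<Gamma> (add_mset (HEx STm A, u) \<Delta>) C w"
| u_exL_wd: "x \<notin> hctx_fvW (\<Gamma> \<union> set_mset \<Delta>) \<union> h_fvW A \<union> w_fv u \<union> h_fvW C \<union> w_fv w
              \<Longrightarrow> useq \<Gamma> (add_mset (h_openW 0 (WFree x) A, u) \<Delta>) C w
              \<Longrightarrow> useq \<Gamma> (add_mset (HEx SWd A, u) \<Delta>) C w"
| u_atR: "useq \<Gamma> \<Delta> A u \<Longrightarrow> useq \<Gamma> \<Delta> (HAt A u) v"
| u_atL: "useq \<Gamma> (add_mset (A, u) \<Delta>) C w \<Longrightarrow> useq \<Gamma> (add_mset (HAt A u, v) \<Delta>) C w"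
| u_downR: "useq \<Gamma> \<Delta> (h_openW 0 w A) w \<Longrightarrow> useq \<Gamma> \<Delta> (HDown A) w"
| u_downL: "useq \<Gamma> (add_mset (h_openW 0 v A, v) \<Delta>) C w \<Longrightarrow> useq \<Gamma> (add_mset (HDown A, v) \<Delta>) C w"

datatype ('a, 'f, 'c) pprop =
    PAtom 'a "'f tm list"
  | PTensor "('a, 'f, 'c) pprop" "('a, 'f, 'c) pprop"
  | POne
  | PPlus "('a, 'f, 'c) pprop" "('a, 'f, 'c) pprop"
  | PZero
  | PBang "('a, 'f, 'c) nprop"
  | PEx sort "('a, 'f, 'c) pprop"
  | PDown "('a, 'f, 'c) pprop"
  | PAt "('a, 'f, 'c) pprop" "'c wexp"
  | Pos "('a, 'f, 'c) nprop"
and ('a, 'f, 'c) nprop =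
    NAtom 'a "'f tm list"
  | NWith "('a, 'f, 'c) nprop" "('a, 'f, 'c) nprop"
  | NTop
  | NLolli "('a, 'f, 'c) pprop" "('a, 'f, 'c) nprop"
  | NAll sort "('a, 'f, 'c) nprop"
  | NDown "('a, 'f, 'c) nprop"
  | NAt "('a, 'f, 'c) nprop" "'c wexp"
  | Neg "('a, 'f, 'c) pprop"

primrec p_openT :: "nat \<Rightarrow> 'f tm \<Rightarrow> ('a, 'f, 'c) pprop \<Rightarrow> ('a, 'f, 'c) pprop"
  and n_openT :: "nat \<Rightarrow> 'f tm \<Rightarrow> ('a, 'f, 'c) nprop \<Rightarrow> ('a, 'f, 'c) nprop" where
  "p_openT k t (PAtom a ts) = PAtom a (map (tm_open k t) ts)"
| "p_openT k t (PTensor P Q) = PTensor (p_openT k t P) (p_openT k t Q)"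
| "p_openT k t POne = POne"
| "p_openT k t (PPlus P Q) = PPlus (p_openT k t P) (p_openT k t Q)"
| "p_openT k t PZero = PZero"
| "p_openT k t (PBang N) = PBang (n_openT k t N)"
| "p_openT k t (PEx s P) = PEx s (p_openT (if s = STm then Suc k else k) t P)"
| "p_openT k t (PDown P) = PDown (p_openT k t P)"
| "p_openT k t (PAt P w) = PAt (p_openT k t P) w"
| "p_openT k t (Pos N) = Pos (n_openT k t N)"
| "n_openT k t (NAtom a ts) = NAtom a (map (tm_open k t) ts)"
| "n_openT k t (NWith M N) = NWith (n_openT k t M) (n_openT k t N)"
| "n_openT k t NTop = NTop"
| "n_openT k t (NLolli P N) = NLolli (p_openT k t P) (n_openT k t N)"
| "n_openT k t (NAll s N) = NAll s (n_openT (if s = STm then Suc k else k) t N)"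
| "n_openT k t (NDown N) = NDown (n_openT k t N)"
| "n_openT k t (NAt N w) = NAt (n_openT k t N) w"
| "n_openT k t (Neg P) = Neg (p_openT k t P)"

primrec p_openW :: "nat \<Rightarrow> 'c wexp \<Rightarrow> ('a, 'f, 'c) pprop \<Rightarrow> ('a, 'f, 'c) pprop"
  and n_openW :: "nat \<Rightarrow> 'c wexp \<Rightarrow> ('a, 'f, 'c) nprop \<Rightarrow> ('a, 'f, 'c) nprop" where
  "p_openW k v (PAtom a ts) = PAtom a ts"
| "p_openW k v (PTensor P Q) = PTensor (p_openW k v P) (p_openW k v Q)"
| "p_openW k v POne = POne"
| "p_openW k v (PPlus P Q) = PPlus (p_openW k v P) (p_openW k v Q)"
| "p_openW k v PZero = PZero"
| "p_openW k v (PBang N) = PBang (n_openW k v N)"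
| "p_openW k v (PEx s P) = PEx s (p_openW (if s = SWd then Suc k else k) v P)"
| "p_openW k v (PDown P) = PDown (p_openW (Suc k) v P)"
| "p_openW k v (PAt P w) = PAt (p_openW k v P) (w_open k v w)"
| "p_openW k v (Pos N) = Pos (n_openW k v N)"
| "n_openW k v (NAtom a ts) = NAtom a ts"
| "n_openW k v (NWith M N) = NWith (n_openW k v M) (n_openW k v N)"
| "n_openW k v NTop = NTop"
| "n_openW k v (NLolli P N) = NLolli (p_openW k v P) (n_openW k v N)"
| "n_openW k v (NAll s N) = NAll s (n_openW (if s = SWd then Suc k else k) v N)"
| "n_openW k v (NDown N) = NDown (n_openW (Suc k) v N)"
| "n_openW k v (NAt N w) = NAt (n_openW k v N) (w_open k v w)"
| "n_openW k v (Neg P) = Neg (p_openW k v P)"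

primrec p_fvT :: "('a, 'f, 'c) pprop \<Rightarrow> nat set"
  and n_fvT :: "('a, 'f, 'c) nprop \<Rightarrow> nat set" where
  "p_fvT (PAtom a ts) = \<Union> (set (map tm_fv ts))"
| "p_fvT (PTensor P Q) = p_fvT P \<union> p_fvT Q"
| "p_fvT POne = {}"
| "p_fvT (PPlus P Q) = p_fvT P \<union> p_fvT Q"
| "p_fvT PZero = {}"
| "p_fvT (PBang N) = n_fvT N"
| "p_fvT (PEx s P) = p_fvT P"
| "p_fvT (PDown P) = p_fvT P"
| "p_fvT (PAt P w) = p_fvT P"
| "p_fvT (Pos N) = n_fvT N"
| "n_fvT (NAtom a ts) = \<Union> (set (map tm_fv ts))"
| "n_fvT (NWith M N) = n_fvT M \<union> n_fvT N"
| "n_fvT NTop = {}"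
| "n_fvT (NLolli P N) = p_fvT P \<union> n_fvT N"
| "n_fvT (NAll s N) = n_fvT N"
| "n_fvT (NDown N) = n_fvT N"
| "n_fvT (NAt N w) = n_fvT N"
| "n_fvT (Neg P) = p_fvT P"

primrec p_fvW :: "('a, 'f, 'c) pprop \<Rightarrow> nat set"
  and n_fvW :: "('a, 'f, 'c) nprop \<Rightarrow> nat set" where
  "p_fvW (PAtom a ts) = {}"
| "p_fvW (PTensor P Q) = p_fvW P \<union> p_fvW Q"
| "p_fvW POne = {}"
| "p_fvW (PPlus P Q) = p_fvW P \<union> p_fvW Q"
| "p_fvW PZero = {}"
| "p_fvW (PBang N) = n_fvW N"
| "p_fvW (PEx s P) = p_fvW P"
| "p_fvW (PDown P) = p_fvW P"
| "p_fvW (PAt P w) = p_fvW P \<union> w_fv w"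
| "p_fvW (Pos N) = n_fvW N"
| "n_fvW (NAtom a ts) = {}"
| "n_fvW (NWith M N) = n_fvW M \<union> n_fvW N"
| "n_fvW NTop = {}"
| "n_fvW (NLolli P N) = p_fvW P \<union> n_fvW N"
| "n_fvW (NAll s N) = n_fvW N"
| "n_fvW (NDown N) = n_fvW N"
| "n_fvW (NAt N w) = n_fvW N \<union> w_fv w"
| "n_fvW (Neg P) = p_fvW P"

primrec eraseP :: "('a, 'f, 'c) pprop \<Rightarrow> ('a, 'f, 'c) hprop"
  and eraseN :: "('a, 'f, 'c) nprop \<Rightarrow> ('a, 'f, 'c) hprop" where
  "eraseP (PAtom a ts) = HAtom a ts"
| "eraseP (PTensor P Q) = HTensor (eraseP P) (eraseP Q)"
| "eraseP POne = HOne"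
| "eraseP (PPlus P Q) = HPlus (eraseP P) (eraseP Q)"
| "eraseP PZero = HZero"
| "eraseP (PBang N) = HBang (eraseN N)"
| "eraseP (PEx s P) = HEx s (eraseP P)"
| "eraseP (PDown P) = HDown (eraseP P)"
| "eraseP (PAt P w) = HAt (eraseP P) w"
| "eraseP (Pos N) = eraseN N"
| "eraseN (NAtom a ts) = HAtom a ts"
| "eraseN (NWith M N) = HWith (eraseN M) (eraseN N)"
| "eraseN NTop = HTop"
| "eraseN (NLolli P N) = HLolli (eraseP P) (eraseN N)"
| "eraseN (NAll s N) = HAll s (eraseN N)"
| "eraseN (NDown N) = HDown (eraseN N)"
| "eraseN (NAt N w) = HAt (eraseN N) w"
| "eraseN (Neg P) = eraseP P"

primrec polokP :: "('a \<Rightarrow> bool) \<Rightarrow> ('a, 'f, 'c) pprop \<Rightarrow> bool"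
  and polokN :: "('a \<Rightarrow> bool) \<Rightarrow> ('a, 'f, 'c) nprop \<Rightarrow> bool" where
  "polokP pol (PAtom a ts) = pol a"
| "polokP pol (PTensor P Q) = (polokP pol P \<and> polokP pol Q)"
| "polokP pol POne = True"
| "polokP pol (PPlus P Q) = (polokP pol P \<and> polokP pol Q)"
| "polokP pol PZero = True"
| "polokP pol (PBang N) = polokN pol N"
| "polokP pol (PEx s P) = polokP pol P"
| "polokP pol (PDown P) = polokP pol P"
| "polokP pol (PAt P w) = polokP pol P"
| "polokP pol (Pos N) = polokN pol N"
| "polokN pol (NAtom a ts) = (\<not> pol a)"
| "polokN pol (NWith M N) = (polokN pol M \<and> polokN pol N)"
| "polokN pol NTop = True"
| "polokN pol (NLolli P N) = (polokP pol P \<and> polokN pol N)"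
| "polokN pol (NAll s N) = polokN pol N"
| "polokN pol (NDown N) = polokN pol N"
| "polokN pol (NAt N w) = polokN pol N"
| "polokN pol (Neg P) = polokP pol P"

definition pos_polarization :: "('a \<Rightarrow> bool) \<Rightarrow> ('a, 'f, 'c) pprop \<Rightarrow> ('a, 'f, 'c) hprop \<Rightarrow> bool" where
  "pos_polarization pol P A \<longleftrightarrow> polokP pol P \<and> eraseP P = A"

definition neg_polarization :: "('a \<Rightarrow> bool) \<Rightarrow> ('a, 'f, 'c) nprop \<Rightarrow> ('a, 'f, 'c) hprop \<Rightarrow> bool" where
  "neg_polarization pol N A \<longleftrightarrow> polokN pol N \<and> eraseN N = A"

type_synonym ('a, 'f, 'c) pjdg = "('a, 'f, 'c) pprop \<times> 'c wexp"
type_synonym ('a, 'f, 'c) njdg = "('a, 'f, 'c) nprop \<times> 'c wexp"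

text \<open>Right-hand sides of active sequents: RP Q w is "\<cdot>;Q@w", RN N w is "N@w;\<cdot>".\<close>
datatype ('a, 'f, 'c) rhs = RP "('a, 'f, 'c) pprop" "'c wexp" | RN "('a, 'f, 'c) nprop" "'c wexp"

primrec rhs_fvT :: "('a, 'f, 'c) rhs \<Rightarrow> nat set" where
  "rhs_fvT (RP P w) = p_fvT P"
| "rhs_fvT (RN N w) = n_fvT N"

primrec rhs_fvW :: "('a, 'f, 'c) rhs \<Rightarrow> nat set" where
  "rhs_fvW (RP P w) = p_fvW P \<union> w_fv w"
| "rhs_fvW (RN N w) = n_fvW N \<union> w_fv w"

definition fctx_fvT :: "('a, 'f, 'c) njdg set \<Rightarrow> ('a, 'f, 'c) njdg multiset
                         \<Rightarrow> ('a, 'f, 'c) pjdg multiset \<Rightarrow> nat set" where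
  "fctx_fvT \<Gamma> \<Delta> \<Omega> = (\<Union>(N, u)\<in>\<Gamma> \<union> set_mset \<Delta>. n_fvT N) \<union> (\<Union>(P, u)\<in>set_mset \<Omega>. p_fvT P)"

definition fctx_fvW :: "('a, 'f, 'c) njdg set \<Rightarrow> ('a, 'f, 'c) njdg multiset
                         \<Rightarrow> ('a, 'f, 'c) pjdg multiset \<Rightarrow> nat set" where
  "fctx_fvW \<Gamma> \<Delta> \<Omega> = (\<Union>(N, u)\<in>\<Gamma> \<union> set_mset \<Delta>. n_fvW N \<union> w_fv u)
                      \<union> (\<Union>(P, u)\<in>set_mset \<Omega>. p_fvW P \<union> w_fv u)"

text \<open>act \<Gamma> \<Delta> \<Omega> R : active sequent \<Gamma>;\<Delta>;\<Omega> \<Rightarrow> R.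
  lfoc \<Gamma> \<Delta> N u Q w : left-focused sequent \<Gamma>;\<Delta>;[N@u] \<Rightarrow> Q@w.
  rfoc \<Gamma> \<Delta> P w : right-focused sequent \<Gamma>;\<Delta> \<Rightarrow> [P@w].\<close>
inductive act :: "('a, 'f, 'c::monoid_mult) njdg set \<Rightarrow> ('a, 'f, 'c) njdg multiset
                   \<Rightarrow> ('a, 'f, 'c) pjdg multiset \<Rightarrow> ('a, 'f, 'c) rhs \<Rightarrow> bool"
  and lfoc :: "('a, 'f, 'c::monoid_mult) njdg set \<Rightarrow> ('a, 'f, 'c) njdg multiset
                   \<Rightarrow> ('a, 'f, 'c) nprop \<Rightarrow> 'c wexp \<Rightarrow> ('a, 'f, 'c) pprop \<Rightarrow> 'c wexp \<Rightarrow> bool"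
  and rfoc :: "('a, 'f, 'c::monoid_mult) njdg set \<Rightarrow> ('a, 'f, 'c) njdg multiset
                   \<Rightarrow> ('a, 'f, 'c) pprop \<Rightarrow> 'c wexp \<Rightarrow> bool"
where
  f_li: "weq u w \<Longrightarrow> lfoc \<Gamma> {#} (NAtom n ts) u (Pos (NAtom n ts)) w"
| f_negL: "act \<Gamma> \<Delta> {#(P, u)#} (RP Q w) \<Longrightarrow> lfoc \<Gamma> \<Delta> (Neg P) u Q w"
| f_posR: "act \<Gamma> \<Delta> {#} (RN N w) \<Longrightarrow> rfoc \<Gamma> \<Delta> (Pos N) w"
| f_withL1: "lfoc \<Gamma> \<Delta> N1 u Q w \<Longrightarrow> lfoc \<Gamma> \<Delta> (NWith N1 N2) u Q w"
| f_withL2: "lfoc \<Gamma> \<Delta> N2 u Q w \<Longrightarrow> lfoc \<Gamma> \<Delta> (NWith N1 N2) u Q w"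
| f_lolliL: "rfoc \<Gamma> \<Delta> P u \<Longrightarrow> lfoc \<Gamma> \<Xi> N u Q w \<Longrightarrow> lfoc \<Gamma> (\<Delta> + \<Xi>) (NLolli P N) u Q w"
| f_allL_tm: "tm_lc t \<Longrightarrow> lfoc \<Gamma> \<Delta> (n_openT 0 t N) u Q w \<Longrightarrow> lfoc \<Gamma> \<Delta> (NAll STm N) u Q w"
| f_allL_wd: "w_lc v \<Longrightarrow> lfoc \<Gamma> \<Delta> (n_openW 0 v N) u Q w \<Longrightarrow> lfoc \<Gamma> \<Delta> (NAll SWd N) u Q w"
| f_downLF: "lfoc \<Gamma> \<Delta> (n_openW 0 v N) v Q w \<Longrightarrow> lfoc \<Gamma> \<Delta> (NDown N) v Q w"
| f_atLF: "lfoc \<Gamma> \<Delta> N u Q w \<Longrightarrow> lfoc \<Gamma> \<Delta> (NAt N u) v Q w"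
| f_ri: "weq u w \<Longrightarrow> rfoc \<Gamma> {#(Neg (PAtom p ts), u)#} (PAtom p ts) w"
| f_tensorR: "rfoc \<Gamma> \<Delta> P w \<Longrightarrow> rfoc \<Gamma> \<Xi> Q w \<Longrightarrow> rfoc \<Gamma> (\<Delta> + \<Xi>) (PTensor P Q) w"
| f_plusR1: "rfoc \<Gamma> \<Delta> P1 w \<Longrightarrow> rfoc \<Gamma> \<Delta> (PPlus P1 P2) w"
| f_plusR2: "rfoc \<Gamma> \<Delta> P2 w \<Longrightarrow> rfoc \<Gamma> \<Delta> (PPlus P1 P2) w"
| f_exR_tm: "tm_lc t \<Longrightarrow> rfoc \<Gamma> \<Delta> (p_openT 0 t P) w \<Longrightarrow> rfoc \<Gamma> \<Delta> (PEx STm P) w"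
| f_exR_wd: "w_lc v \<Longrightarrow> rfoc \<Gamma> \<Delta> (p_openW 0 v P) w \<Longrightarrow> rfoc \<Gamma> \<Delta> (PEx SWd P) w"
| f_bangR: "act \<Gamma> {#} {#} (RN N w) \<Longrightarrow> rfoc \<Gamma> {#} (PBang N) w"
| f_downRF: "rfoc \<Gamma> \<Delta> (p_openW 0 w P) w \<Longrightarrow> rfoc \<Gamma> \<Delta> (PDown P) w"
| f_atRF: "rfoc \<Gamma> \<Delta> P u \<Longrightarrow> rfoc \<Gamma> \<Delta> (PAt P u) w"
| f_oneR: "rfoc \<Gamma> {#} POne w"
| a_tensorL: "act \<Gamma> \<Delta> (add_mset (P, u) (add_mset (Q, u) \<Omega>)) R
              \<Longrightarrow> act \<Gamma> \<Delta> (add_mset (PTensor P Q, u) \<Omega>) R"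
| a_oneL: "act \<Gamma> \<Delta> \<Omega> R \<Longrightarrow> act \<Gamma> \<Delta> (add_mset (POne, u) \<Omega>) R"
| a_plusL: "act \<Gamma> \<Delta> (add_mset (P, u) \<Omega>) R \<Longrightarrow> act \<Gamma> \<Delta> (add_mset (Q, u) \<Omega>) R
              \<Longrightarrow> act \<Gamma> \<Delta> (add_mset (PPlus P Q, u) \<Omega>) R"
| a_downLA: "act \<Gamma> \<Delta> (add_mset (p_openW 0 v P, v) \<Omega>) R \<Longrightarrow> act \<Gamma> \<Delta> (add_mset (PDown P, v) \<Omega>) R"
| a_atLA: "act \<Gamma> \<Delta> (add_mset (P, u) \<Omega>) R \<Longrightarrow> act \<Gamma> \<Delta> (add_mset (PAt P u, v) \<Omega>) R"
| a_exL_tm: "x \<notin> fctx_fvT \<Gamma> \<Delta> \<Omega> \<union> p_fvT P \<union> rhs_fvT R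
              \<Longrightarrow> act \<Gamma> \<Delta> (add_mset (p_openT 0 (TFree x) P, u) \<Omega>) R
              \<Longrightarrow> act \<Gamma> \<Delta> (add_mset (PEx STm P, u) \<Omega>) R"
| a_exL_wd: "x \<notin> fctx_fvW \<Gamma> \<Delta> \<Omega> \<union> p_fvW P \<union> w_fv u \<union> rhs_fvW R
              \<Longrightarrow> act \<Gamma> \<Delta> (add_mset (p_openW 0 (WFree x) P, u) \<Omega>) R
              \<Longrightarrow> act \<Gamma> \<Delta> (add_mset (PEx SWd P, u) \<Omega>) R"
| a_bangL: "act (insert (N, u) \<Gamma>) \<Delta> \<Omega> R \<Longrightarrow> act \<Gamma> \<Delta> (add_mset (PBang N, u) \<Omega>) R"
| a_posL: "act \<Gamma> (add_mset (N, w) \<Delta>) \<Omega> R \<Longrightarrow> act \<Gamma> \<Delta> (add_mset (Pos N, w) \<Omega>) R"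
| a_lp: "act \<Gamma> (add_mset (Neg (PAtom p ts), w) \<Delta>) \<Omega> R
              \<Longrightarrow> act \<Gamma> \<Delta> (add_mset (PAtom p ts, w) \<Omega>) R"
| a_zeroL: "act \<Gamma> \<Delta> (add_mset (PZero, u) \<Omega>) R"
| a_withR: "act \<Gamma> \<Delta> \<Omega> (RN M w) \<Longrightarrow> act \<Gamma> \<Delta> \<Omega> (RN N w) \<Longrightarrow> act \<Gamma> \<Delta> \<Omega> (RN (NWith M N) w)"
| a_topR: "act \<Gamma> \<Delta> \<Omega> (RN NTop w)"
| a_lolliR: "act \<Gamma> \<Delta> (add_mset (P, w) \<Omega>) (RN N w) \<Longrightarrow> act \<Gamma> \<Delta> \<Omega> (RN (NLolli P N) w)"
| a_downRA: "act \<Gamma> \<Delta> \<Omega> (RN (n_openW 0 w N) w) \<Longrightarrow> act \<Gamma> \<Delta> \<Omega> (RN (NDown N) w)"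
| a_atRA: "act \<Gamma> \<Delta> \<Omega> (RN N u) \<Longrightarrow> act \<Gamma> \<Delta> \<Omega> (RN (NAt N u) w)"
| a_allR_tm: "x \<notin> fctx_fvT \<Gamma> \<Delta> \<Omega> \<union> n_fvT N
              \<Longrightarrow> act \<Gamma> \<Delta> \<Omega> (RN (n_openT 0 (TFree x) N) u)
              \<Longrightarrow> act \<Gamma> \<Delta> \<Omega> (RN (NAll STm N) u)"
| a_allR_wd: "x \<notin> fctx_fvW \<Gamma> \<Delta> \<Omega> \<union> n_fvW N \<union> w_fv u
              \<Longrightarrow> act \<Gamma> \<Delta> \<Omega> (RN (n_openW 0 (WFree x) N) u)
              \<Longrightarrow> act \<Gamma> \<Delta> \<Omega> (RN (NAll SWd N) u)"
| a_negR: "act \<Gamma> \<Delta> \<Omega> (RP P w) \<Longrightarrow> act \<Gamma> \<Delta> \<Omega> (RN (Neg P) w)"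
| a_rp: "act \<Gamma> \<Delta> \<Omega> (RP (Pos (NAtom n ts)) w) \<Longrightarrow> act \<Gamma> \<Delta> \<Omega> (RN (NAtom n ts) w)"
| d_lf: "lfoc \<Gamma> \<Delta> N u Q w \<Longrightarrow> (\<forall>p ts. N \<noteq> Neg (PAtom p ts))
              \<Longrightarrow> act \<Gamma> (add_mset (N, u) \<Delta>) {#} (RP Q w)"
| d_cplf: "(N, u) \<in> \<Gamma> \<Longrightarrow> lfoc \<Gamma> \<Delta> N u Q w \<Longrightarrow> act \<Gamma> \<Delta> {#} (RP Q w)"
| d_rf: "rfoc \<Gamma> \<Delta> P w \<Longrightarrow> (\<forall>n ts. P \<noteq> Pos (NAtom n ts))
              \<Longrightarrow> act \<Gamma> \<Delta> {#} (RP P w)"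

end

theory Submission
  imports Defs
begin

text \<open>Completeness of focusing by a phase-semantic argument in the style of Okada's proof of cut
  elimination.  An unpolarized proposition at a world is interpreted as a set of stable contexts
  \<open>(\<Gamma>, \<Delta>)\<close>, closed under a biorthogonality with respect to derivability of the stable focused
  sequents \<open>\<Gamma>; \<Delta>; \<cdot> \<Rightarrow> \<cdot>; Q@w\<close>.  The unfocused rules are sound in this model.  Conversely, for
  every polarization, a context that can be left-focused on \<open>N\<close> belongs to the interpretation of
  \<open>N\<close>; each element of the interpretation of \<open>P\<close> is covered by contexts from which \<open>P\<close> is
  right-focus derivable; and an active sequent is derivable as soon as every interpretation of its
  positive context satisfies its right-hand side.  Since the interpretation ignores shifts,
  different occurrences of a proposition may be polarized differently, and neither cut, identity
  expansion, inversion nor weakening is needed for the focused calculus.\<close>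

section \<open>Simultaneous substitution\<close>

primrec tm_subst :: "(nat \<Rightarrow> 'f tm) \<Rightarrow> 'f tm \<Rightarrow> 'f tm" where
  "tm_subst \<sigma> (TFree x) = \<sigma> x"
| "tm_subst \<sigma> (TBnd i) = TBnd i"
| "tm_subst \<sigma> (TFn f ts) = TFn f (map (tm_subst \<sigma>) ts)"

primrec w_subst :: "(nat \<Rightarrow> 'c wexp) \<Rightarrow> 'c wexp \<Rightarrow> 'c wexp" where
  "w_subst \<tau> (WConst c) = WConst c"
| "w_subst \<tau> WUnit = WUnit"
| "w_subst \<tau> (WMul a b) = WMul (w_subst \<tau> a) (w_subst \<tau> b)"
| "w_subst \<tau> (WFree x) = \<tau> x"
| "w_subst \<tau> (WBnd i) = WBnd i"

text \<open>Soundness is shown for all instances under such a pair of substitutions. An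
  eigenvariable is then sent to an arbitrary term or world by updating the substitution at one name,
  so derivations never have to be renamed.\<close>

primrec h_subst :: "(nat \<Rightarrow> 'f tm) \<Rightarrow> (nat \<Rightarrow> 'c wexp) \<Rightarrow> ('a, 'f, 'c) hprop \<Rightarrow> ('a, 'f, 'c) hprop" where
  "h_subst \<sigma> \<tau> (HAtom a ts) = HAtom a (map (tm_subst \<sigma>) ts)"
| "h_subst \<sigma> \<tau> (HTensor A B) = HTensor (h_subst \<sigma> \<tau> A) (h_subst \<sigma> \<tau> B)"
| "h_subst \<sigma> \<tau> HOne = HOne"
| "h_subst \<sigma> \<tau> (HLolli A B) = HLolli (h_subst \<sigma> \<tau> A) (h_subst \<sigma> \<tau> B)"
| "h_subst \<sigma> \<tau> (HWith A B) = HWith (h_subst \<sigma> \<tau> A) (h_subst \<sigma> \<tau> B)"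
| "h_subst \<sigma> \<tau> HTop = HTop"
| "h_subst \<sigma> \<tau> (HPlus A B) = HPlus (h_subst \<sigma> \<tau> A) (h_subst \<sigma> \<tau> B)"
| "h_subst \<sigma> \<tau> HZero = HZero"
| "h_subst \<sigma> \<tau> (HBang A) = HBang (h_subst \<sigma> \<tau> A)"
| "h_subst \<sigma> \<tau> (HAll s A) = HAll s (h_subst \<sigma> \<tau> A)"
| "h_subst \<sigma> \<tau> (HEx s A) = HEx s (h_subst \<sigma> \<tau> A)"
| "h_subst \<sigma> \<tau> (HAt A w) = HAt (h_subst \<sigma> \<tau> A) (w_subst \<tau> w)"
| "h_subst \<sigma> \<tau> (HDown A) = HDown (h_subst \<sigma> \<tau> A)"

lemma tm_open_lc: "tm_lc s \<Longrightarrow> tm_open k t s = s"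
  by (induction s) (auto simp: list_all_iff map_idI)

lemma w_open_lc: "w_lc s \<Longrightarrow> w_open k t s = s"
  by (induction s) auto

text \<open>A locally closed image has no index left to open, so the opening at \<open>k\<close>
  cannot disturb what \<open>\<sigma>\<close> inserts.\<close>

lemma tm_subst_open:
  "\<forall>x. tm_lc (\<sigma> x) \<Longrightarrow> tm_subst \<sigma> (tm_open k t s) = tm_open k (tm_subst \<sigma> t) (tm_subst \<sigma> s)"
  by (induction s) (auto simp: tm_open_lc)

lemma w_subst_open:
  "\<forall>x. w_lc (\<tau> x) \<Longrightarrow> w_subst \<tau> (w_open k v u) = w_open k (w_subst \<tau> v) (w_subst \<tau> u)"
  by (induction u) (auto simp: w_open_lc)

lemma h_subst_openT:
  "\<forall>x. tm_lc (\<sigma> x) \<Longrightarrow> h_subst \<sigma> \<tau> (h_openT k t A) = h_openT k (tm_subst \<sigma> t) (h_subst \<sigma> \<tau> A)"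
  by (induction A arbitrary: k) (auto simp: tm_subst_open)

lemma h_subst_openW:
  "\<forall>x. w_lc (\<tau> x) \<Longrightarrow> h_subst \<sigma> \<tau> (h_openW k v A) = h_openW k (w_subst \<tau> v) (h_subst \<sigma> \<tau> A)"
  by (induction A arbitrary: k) (auto simp: w_subst_open)

lemma tm_subst_lc: "\<forall>x. tm_lc (\<sigma> x) \<Longrightarrow> tm_lc t \<Longrightarrow> tm_lc (tm_subst \<sigma> t)"
  by (induction t) (auto simp: list_all_iff)

lemma w_subst_lc: "\<forall>x. w_lc (\<tau> x) \<Longrightarrow> w_lc v \<Longrightarrow> w_lc (w_subst \<tau> v)"
  by (induction v) auto

lemma tm_subst_upd: "x \<notin> tm_fv s \<Longrightarrow> tm_subst (\<sigma>(x := t)) s = tm_subst \<sigma> s"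
  by (induction s) auto

lemma w_subst_upd: "x \<notin> w_fv u \<Longrightarrow> w_subst (\<tau>(x := v)) u = w_subst \<tau> u"
  by (induction u) auto

lemma h_subst_updT: "x \<notin> h_fvT A \<Longrightarrow> h_subst (\<sigma>(x := t)) \<tau> A = h_subst \<sigma> \<tau> A"
  by (induction A) (auto simp: tm_subst_upd)

lemma h_subst_updW: "x \<notin> h_fvW A \<Longrightarrow> h_subst \<sigma> (\<tau>(x := v)) A = h_subst \<sigma> \<tau> A"
  by (induction A) (auto simp: w_subst_upd)

lemma tm_subst_TFree: "tm_subst TFree t = t"
  by (induction t) (auto simp: map_idI)

lemma w_subst_WFree: "w_subst WFree u = u"
  by (induction u) auto

lemma h_subst_free: "h_subst TFree WFree A = A"
  by (induction A) (auto simp: tm_subst_TFree w_subst_WFree map_idI)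

lemma weq_subst: "weq u v \<Longrightarrow> weq (w_subst \<tau> u) (w_subst \<tau> v)"
  by (induction rule: weq.induct) (auto intro: weq.intros)

section \<open>Polarized syntax\<close>

lemma erase_openT:
  fixes P :: "('a, 'f, 'c) pprop" and N :: "('a, 'f, 'c) nprop"
  shows "eraseP (p_openT k t P) = h_openT k t (eraseP P)"
    and "eraseN (n_openT k t N) = h_openT k t (eraseN N)"
  by (induction P and N arbitrary: k and k rule: pprop.induct nprop.induct) auto

lemma erase_openW:
  fixes P :: "('a, 'f, 'c) pprop" and N :: "('a, 'f, 'c) nprop"
  shows "eraseP (p_openW k v P) = h_openW k v (eraseP P)"
    and "eraseN (n_openW k v N) = h_openW k v (eraseN N)"
  by (induction P and N arbitrary: k and k rule: pprop.induct nprop.induct) auto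

lemma polok_openT:
  fixes P :: "('a, 'f, 'c) pprop" and N :: "('a, 'f, 'c) nprop"
  shows "polokP pol (p_openT k t P) = polokP pol P"
    and "polokN pol (n_openT k t N) = polokN pol N"
  by (induction P and N arbitrary: k and k rule: pprop.induct nprop.induct) auto

lemma polok_openW:
  fixes P :: "('a, 'f, 'c) pprop" and N :: "('a, 'f, 'c) nprop"
  shows "polokP pol (p_openW k v P) = polokP pol P"
    and "polokN pol (n_openW k v N) = polokN pol N"
  by (induction P and N arbitrary: k and k rule: pprop.induct nprop.induct) auto

section \<open>Size of polarized propositions, finiteness of free variables and fresh names\<close>

primrec p_size :: "('a, 'f, 'c) pprop \<Rightarrow> nat"
  and n_size :: "('a, 'f, 'c) nprop \<Rightarrow> nat" where
  "p_size (PAtom a ts) = 1"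
| "p_size (PTensor P Q) = Suc (p_size P + p_size Q)"
| "p_size POne = 1"
| "p_size (PPlus P Q) = Suc (p_size P + p_size Q)"
| "p_size PZero = 1"
| "p_size (PBang N) = Suc (n_size N)"
| "p_size (PEx s P) = Suc (p_size P)"
| "p_size (PDown P) = Suc (p_size P)"
| "p_size (PAt P w) = Suc (p_size P)"
| "p_size (Pos N) = Suc (n_size N)"
| "n_size (NAtom a ts) = 1"
| "n_size (NWith M N) = Suc (n_size M + n_size N)"
| "n_size NTop = 1"
| "n_size (NLolli P N) = Suc (p_size P + n_size N)"
| "n_size (NAll s N) = Suc (n_size N)"
| "n_size (NDown N) = Suc (n_size N)"
| "n_size (NAt N w) = Suc (n_size N)"
| "n_size (Neg P) = Suc (p_size P)"

text \<open>Terms carry no weight in the size, so a quantified proposition is larger than each of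
  its instances, although these are not syntactic parts of it. Inductions on size can therefore pass
  through binders.\<close>

lemma size_openT [simp]:
  fixes P :: "('a, 'f, 'c) pprop" and N :: "('a, 'f, 'c) nprop"
  shows "p_size (p_openT k t P) = p_size P"
    and "n_size (n_openT k t N) = n_size N"
  by (induction P and N arbitrary: k and k rule: pprop.induct nprop.induct) auto

lemma size_openW [simp]:
  fixes P :: "('a, 'f, 'c) pprop" and N :: "('a, 'f, 'c) nprop"
  shows "p_size (p_openW k v P) = p_size P"
    and "n_size (n_openW k v N) = n_size N"
  by (induction P and N arbitrary: k and k rule: pprop.induct nprop.induct) auto

lemma finite_tm_fv [simp]: "finite (tm_fv t)"
  by (induction t) auto

lemma finite_w_fv [simp]: "finite (w_fv u)"
  by (induction u) auto

lemma finite_fvT [simp]: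
  fixes P :: "('a, 'f, 'c) pprop" and N :: "('a, 'f, 'c) nprop"
  shows "finite (p_fvT P)" and "finite (n_fvT N)"
  by (induction P and N rule: pprop.induct nprop.induct) auto

lemma finite_fvW [simp]:
  fixes P :: "('a, 'f, 'c) pprop" and N :: "('a, 'f, 'c) nprop"
  shows "finite (p_fvW P)" and "finite (n_fvW N)"
  by (induction P and N rule: pprop.induct nprop.induct) auto

lemma finite_fctx_fvT [simp]: "finite \<Gamma> \<Longrightarrow> finite (fctx_fvT \<Gamma> \<Delta> \<Omega>)"
  by (auto simp: fctx_fvT_def)

lemma finite_fctx_fvW [simp]: "finite \<Gamma> \<Longrightarrow> finite (fctx_fvW \<Gamma> \<Delta> \<Omega>)"
  by (auto simp: fctx_fvW_def)

lemma finite_rhs_fv [simp]: "finite (rhs_fvT R)" "finite (rhs_fvW R)"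
  by (cases R; simp)+

lemma fresh_nat: "finite (S :: nat set) \<Longrightarrow> \<exists>x. x \<notin> S"
  using ex_new_if_finite infinite_UNIV_nat by blast

section \<open>A phase model made of stable focused sequents\<close>

type_synonym ('a, 'f, 'c) ctxpred = "('a, 'f, 'c) njdg set \<Rightarrow> ('a, 'f, 'c) njdg multiset \<Rightarrow> bool"

definition ext :: "'j set \<Rightarrow> 'j set \<Rightarrow> bool" where
  "ext \<Gamma> \<Gamma>' \<longleftrightarrow> \<Gamma> \<subseteq> \<Gamma>' \<and> finite \<Gamma>'"

lemma ext_refl: "finite \<Gamma> \<Longrightarrow> ext \<Gamma> \<Gamma>"
  and ext_trans: "ext \<Gamma> \<Gamma>' \<Longrightarrow> ext \<Gamma>' \<Gamma>'' \<Longrightarrow> ext \<Gamma> \<Gamma>''"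
  and ext_finite: "ext \<Gamma> \<Gamma>' \<Longrightarrow> finite \<Gamma>'"
  by (auto simp: ext_def)

text \<open>The model is Kripke-style in the persistent context, so no weakening lemma is needed.
  The frames \<open>\<Xi>\<close> and \<open>Q\<close> are stable: a frame with positive hypotheses would have to be inverted
  before a left focus on \<open>neg P\<close>.  Finiteness of \<open>\<Gamma>\<close>, built into \<^const>\<open>ext\<close>, guarantees fresh
  eigenvariables.\<close>

definition cl :: "('a, 'f, 'c::monoid_mult) ctxpred \<Rightarrow> ('a, 'f, 'c) ctxpred" where
  "cl X \<Gamma> \<Delta> \<longleftrightarrow> (\<forall>\<Gamma>' \<Xi> Q w. ext \<Gamma> \<Gamma>' \<longrightarrow>
     (\<forall>\<Gamma>'' \<Delta>'. ext \<Gamma>' \<Gamma>'' \<longrightarrow> X \<Gamma>'' \<Delta>' \<longrightarrow> act \<Gamma>'' (\<Delta>' + \<Xi>) {#} (RP Q w)) \<longrightarrow>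
     act \<Gamma>' (\<Delta> + \<Xi>) {#} (RP Q w))"

text \<open>Facts in the sense of phase semantics, with a Kripke monotonicity clause. Closure is
  asked for at finite \<Gamma> only, because an infinite \<Gamma> has no extension under
  \<open>ext\<close> and satisfies \<open>cl X\<close> vacuously.\<close>

definition fact :: "('a, 'f, 'c::monoid_mult) ctxpred \<Rightarrow> bool" where
  "fact X \<longleftrightarrow> (\<forall>\<Gamma> \<Gamma>' \<Delta>. X \<Gamma> \<Delta> \<longrightarrow> ext \<Gamma> \<Gamma>' \<longrightarrow> X \<Gamma>' \<Delta>) \<and>
     (\<forall>\<Gamma> \<Delta>. finite \<Gamma> \<longrightarrow> cl X \<Gamma> \<Delta> \<longrightarrow> X \<Gamma> \<Delta>)"

lemma fact_mono: "fact X \<Longrightarrow> X \<Gamma> \<Delta> \<Longrightarrow> ext \<Gamma> \<Gamma>' \<Longrightarrow> X \<Gamma>' \<Delta>"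
  unfolding fact_def by blast

lemma fact_closed: "fact X \<Longrightarrow> finite \<Gamma> \<Longrightarrow> cl X \<Gamma> \<Delta> \<Longrightarrow> X \<Gamma> \<Delta>"
  unfolding fact_def by blast

lemma clI:
  assumes "\<And>\<Gamma>' \<Xi> Q w. ext \<Gamma> \<Gamma>' \<Longrightarrow>
     (\<And>\<Gamma>'' \<Delta>'. ext \<Gamma>' \<Gamma>'' \<Longrightarrow> X \<Gamma>'' \<Delta>' \<Longrightarrow> act \<Gamma>'' (\<Delta>' + \<Xi>) {#} (RP Q w)) \<Longrightarrow>
     act \<Gamma>' (\<Delta> + \<Xi>) {#} (RP Q w)"
  shows "cl X \<Gamma> \<Delta>"
  unfolding cl_def using assms by blast

lemma clE:
  assumes "cl X \<Gamma> \<Delta>" "ext \<Gamma> \<Gamma>'"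
    and "\<And>\<Gamma>'' \<Delta>'. ext \<Gamma>' \<Gamma>'' \<Longrightarrow> X \<Gamma>'' \<Delta>' \<Longrightarrow> act \<Gamma>'' (\<Delta>' + \<Xi>) {#} (RP Q w)"
  shows "act \<Gamma>' (\<Delta> + \<Xi>) {#} (RP Q w)"
  using assms unfolding cl_def by blast

text \<open>Unit of the closure. The predicate \<open>X\<close> is arbitrary and may fail to be
  monotone, so membership is asked for at every extension.\<close>

lemma cl_unit:
  assumes "\<And>\<Gamma>'. ext \<Gamma> \<Gamma>' \<Longrightarrow> X \<Gamma>' \<Delta>"
  shows "cl X \<Gamma> \<Delta>"
  by (rule clI) (use assms ext_refl ext_finite in blast)

lemma cl_mono: "cl X \<Gamma> \<Delta> \<Longrightarrow> ext \<Gamma> \<Gamma>' \<Longrightarrow> cl X \<Gamma>' \<Delta>"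
  unfolding cl_def using ext_trans by blast

text \<open>A test with frame \<Xi> on \<open>\<Delta> + D\<close> is a test with frame
  \<open>D + \<Xi>\<close> on \<Delta>. Hence an element of \<open>cl X\<close> may be treated as an
  element of \<open>X\<close> whenever the goal is membership in a fact.\<close>

lemma cl_bind:
  assumes "fact Y" "finite \<Gamma>" "cl X \<Gamma> \<Delta>"
    and "\<And>\<Gamma>' \<Delta>'. ext \<Gamma> \<Gamma>' \<Longrightarrow> X \<Gamma>' \<Delta>' \<Longrightarrow> Y \<Gamma>' (\<Delta>' + D)"
  shows "Y \<Gamma> (\<Delta> + D)"
proof (rule fact_closed[OF assms(1,2)], rule clI)
  fix \<Gamma>' \<Xi> Q w
  assume e: "ext \<Gamma> \<Gamma>'"
    and k: "\<And>\<Gamma>'' \<Delta>'. ext \<Gamma>' \<Gamma>'' \<Longrightarrow> Y \<Gamma>'' \<Delta>' \<Longrightarrow> act \<Gamma>'' (\<Delta>' + \<Xi>) {#} (RP Q w)"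
  have "act \<Gamma>' (\<Delta> + (D + \<Xi>)) {#} (RP Q w)"
  proof (rule clE[OF assms(3) e])
    fix \<Gamma>'' \<Delta>' assume "ext \<Gamma>' \<Gamma>''" "X \<Gamma>'' \<Delta>'"
    then show "act \<Gamma>'' (\<Delta>' + (D + \<Xi>)) {#} (RP Q w)"
      using k[of \<Gamma>'' "\<Delta>' + D"] assms(4) e ext_trans by (metis add.assoc)
  qed
  then show "act \<Gamma>' (\<Delta> + D + \<Xi>) {#} (RP Q w)" by (simp add: add.assoc)
qed

text \<open>A test passed by all of \<open>X\<close> is also passed by all of \<open>cl X\<close>,
  so closing a second time adds nothing.\<close>

lemma fact_cl: "fact (cl X)"
  unfolding fact_def
proof (intro conjI allI impI)
  fix \<Gamma> \<Gamma>' \<Delta> assume "cl X \<Gamma> \<Delta>" "ext \<Gamma> \<Gamma>'"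
  then show "cl X \<Gamma>' \<Delta>" by (rule cl_mono)
next
  fix \<Gamma> \<Delta> assume c: "cl (cl X) \<Gamma> \<Delta>"
  show "cl X \<Gamma> \<Delta>"
  proof (rule clI)
    fix \<Gamma>' \<Xi> Q w
    assume e: "ext \<Gamma> \<Gamma>'"
      and k: "\<And>\<Gamma>'' \<Delta>'. ext \<Gamma>' \<Gamma>'' \<Longrightarrow> X \<Gamma>'' \<Delta>' \<Longrightarrow> act \<Gamma>'' (\<Delta>' + \<Xi>) {#} (RP Q w)"
    show "act \<Gamma>' (\<Delta> + \<Xi>) {#} (RP Q w)"
    proof (rule clE[OF c e])
      fix \<Gamma>'' \<Delta>' assume e': "ext \<Gamma>' \<Gamma>''" and c': "cl X \<Gamma>'' \<Delta>'"
      show "act \<Gamma>'' (\<Delta>' + \<Xi>) {#} (RP Q w)"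
        by (rule clE[OF c' ext_refl[OF ext_finite[OF e']]]) (use k e' ext_trans in blast)
    qed
  qed
qed

lemma cl_bind0:
  assumes "fact Y" "finite \<Gamma>" "cl X \<Gamma> \<Delta>"
    and "\<And>\<Gamma>' \<Delta>'. ext \<Gamma> \<Gamma>' \<Longrightarrow> X \<Gamma>' \<Delta>' \<Longrightarrow> Y \<Gamma>' \<Delta>'"
  shows "Y \<Gamma> \<Delta>"
  using cl_bind[OF assms(1-3), of "{#}"] assms(4) by simp

section \<open>Operations on context predicates and stability of facts\<close>

definition tensor :: "('a, 'f, 'c) ctxpred \<Rightarrow> ('a, 'f, 'c) ctxpred \<Rightarrow> ('a, 'f, 'c) ctxpred" where
  "tensor X Y \<Gamma> \<Delta> \<longleftrightarrow> (\<exists>\<Delta>1 \<Delta>2. \<Delta> = \<Delta>1 + \<Delta>2 \<and> X \<Gamma> \<Delta>1 \<and> Y \<Gamma> \<Delta>2)"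

text \<open>Kripke implication: the argument may live over a larger persistent context, and its
  linear resources are added to those of the function.\<close>

definition lolli :: "('a, 'f, 'c) ctxpred \<Rightarrow> ('a, 'f, 'c) ctxpred \<Rightarrow> ('a, 'f, 'c) ctxpred" where
  "lolli X Y \<Gamma> \<Delta> \<longleftrightarrow> (\<forall>\<Gamma>' D. ext \<Gamma> \<Gamma>' \<longrightarrow> X \<Gamma>' D \<longrightarrow> Y \<Gamma>' (\<Delta> + D))"

text \<open>For a fixed argument \<open>D\<close> the goal lies in the fact \<open>Y\<close>, so
  \<open>cl_bind\<close> replaces the given closure element by a genuine element of
  \<open>lolli X Y\<close>, which is applied to \<open>D\<close> after moving \<open>D\<close> to
  the larger persistent context.\<close>

lemma fact_lolli:
  assumes "fact X" "fact Y"
  shows "fact (lolli X Y)"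
  unfolding fact_def
proof (intro conjI allI impI)
  fix \<Gamma> \<Gamma>' \<Delta> assume "lolli X Y \<Gamma> \<Delta>" "ext \<Gamma> \<Gamma>'"
  then show "lolli X Y \<Gamma>' \<Delta>" unfolding lolli_def using ext_trans by blast
next
  fix \<Gamma> \<Delta> assume c: "cl (lolli X Y) \<Gamma> \<Delta>"
  show "lolli X Y \<Gamma> \<Delta>"
    unfolding lolli_def
  proof (intro allI impI)
    fix \<Gamma>' D assume e: "ext \<Gamma> \<Gamma>'" and D: "X \<Gamma>' D"
    show "Y \<Gamma>' (\<Delta> + D)"
    proof (rule cl_bind[OF assms(2) ext_finite[OF e] cl_mono[OF c e]])
      fix \<Gamma>'' \<Delta>' assume e': "ext \<Gamma>' \<Gamma>''" and "lolli X Y \<Gamma>'' \<Delta>'"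
      then show "Y \<Gamma>'' (\<Delta>' + D)"
        using fact_mono[OF assms(1) D e'] ext_refl[OF ext_finite[OF e']] unfolding lolli_def by blast
    qed
  qed
qed

text \<open>Facts are stable under intersection: each component is a fact and absorbs the closure of
  the whole intersection.\<close>

lemma fact_all:
  assumes "\<And>i. P i \<Longrightarrow> fact (X i)"
  shows "fact (\<lambda>\<Gamma> \<Delta>. \<forall>i. P i \<longrightarrow> X i \<Gamma> \<Delta>)"
  unfolding fact_def
proof (intro conjI allI impI)
  fix \<Gamma> \<Gamma>' \<Delta> i assume "\<forall>i. P i \<longrightarrow> X i \<Gamma> \<Delta>" "ext \<Gamma> \<Gamma>'" "P i"
  then show "X i \<Gamma>' \<Delta>" using assms fact_mono by blast
next
  fix \<Gamma> \<Delta> i assume f: "finite \<Gamma>" and c: "cl (\<lambda>\<Gamma> \<Delta>. \<forall>i. P i \<longrightarrow> X i \<Gamma> \<Delta>) \<Gamma> \<Delta>" and i: "P i"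
  show "X i \<Gamma> \<Delta>" by (rule cl_bind0[OF assms[OF i] f c]) (use i in blast)
qed

lemma fact_conj:
  assumes "fact X" "fact Y"
  shows "fact (\<lambda>\<Gamma> \<Delta>. X \<Gamma> \<Delta> \<and> Y \<Gamma> \<Delta>)"
  using fact_all[of "\<lambda>_. True" "\<lambda>b. if b then X else Y"] assms
  by (simp add: all_bool_eq conj_commute)

section \<open>Interpretation of unpolarized propositions\<close>

primrec h_size :: "('a, 'f, 'c) hprop \<Rightarrow> nat" where
  "h_size (HAtom a ts) = 1"
| "h_size (HTensor A B) = Suc (h_size A + h_size B)"
| "h_size HOne = 1"
| "h_size (HLolli A B) = Suc (h_size A + h_size B)"
| "h_size (HWith A B) = Suc (h_size A + h_size B)"
| "h_size HTop = 1"
| "h_size (HPlus A B) = Suc (h_size A + h_size B)"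
| "h_size HZero = 1"
| "h_size (HBang A) = Suc (h_size A)"
| "h_size (HAll s A) = Suc (h_size A)"
| "h_size (HEx s A) = Suc (h_size A)"
| "h_size (HAt A w) = Suc (h_size A)"
| "h_size (HDown A) = Suc (h_size A)"

lemma h_size_open [simp]: "h_size (h_openT k t A) = h_size A" "h_size (h_openW k v A) = h_size A"
  by (induction A arbitrary: k) auto

text \<open>Positive connectives are closures of their introduction forms; negative ones are given
  by their eliminations and are facts without a closure; \<open>HAt\<close> and \<open>HDown\<close>
  only move the world. Atoms follow their polarity, and world equality is built in there because
  only \<open>u_init\<close>, \<open>f_li\<close> and \<open>f_ri\<close> refer to it. Quantifiers
  range over all locally closed expressions, free names included, and the recursion is on size
  because it enters opened bodies.\<close>

function sem :: "('a \<Rightarrow> bool) \<Rightarrow> ('a, 'f, 'c::monoid_mult) hprop \<Rightarrow> 'c wexp \<Rightarrow> ('a, 'f, 'c) ctxpred" where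
  "sem pol (HAtom a ts) w =
     (if pol a then cl (\<lambda>\<Gamma> \<Delta>. \<exists>u. weq u w \<and> \<Delta> = {#(Neg (PAtom a ts), u)#})
      else (\<lambda>\<Gamma> \<Delta>. \<forall>\<Gamma>' u. ext \<Gamma> \<Gamma>' \<longrightarrow> weq w u \<longrightarrow> act \<Gamma>' \<Delta> {#} (RP (Pos (NAtom a ts)) u)))"
| "sem pol (HTensor A B) w = cl (tensor (sem pol A w) (sem pol B w))"
| "sem pol HOne w = cl (\<lambda>\<Gamma> \<Delta>. \<Delta> = {#})"
| "sem pol (HLolli A B) w = lolli (sem pol A w) (sem pol B w)"
| "sem pol (HWith A B) w = (\<lambda>\<Gamma> \<Delta>. sem pol A w \<Gamma> \<Delta> \<and> sem pol B w \<Gamma> \<Delta>)"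
| "sem pol HTop w = (\<lambda>\<Gamma> \<Delta>. True)"
| "sem pol (HPlus A B) w = cl (\<lambda>\<Gamma> \<Delta>. sem pol A w \<Gamma> \<Delta> \<or> sem pol B w \<Gamma> \<Delta>)"
| "sem pol HZero w = cl (\<lambda>\<Gamma> \<Delta>. False)"
| "sem pol (HBang A) w = cl (\<lambda>\<Gamma> \<Delta>. \<Delta> = {#} \<and> sem pol A w \<Gamma> {#})"
| "sem pol (HAll STm A) w = (\<lambda>\<Gamma> \<Delta>. \<forall>t. tm_lc t \<longrightarrow> sem pol (h_openT 0 t A) w \<Gamma> \<Delta>)"
| "sem pol (HAll SWd A) w = (\<lambda>\<Gamma> \<Delta>. \<forall>v. w_lc v \<longrightarrow> sem pol (h_openW 0 v A) w \<Gamma> \<Delta>)"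
| "sem pol (HEx STm A) w = cl (\<lambda>\<Gamma> \<Delta>. \<exists>t. tm_lc t \<and> sem pol (h_openT 0 t A) w \<Gamma> \<Delta>)"
| "sem pol (HEx SWd A) w = cl (\<lambda>\<Gamma> \<Delta>. \<exists>v. w_lc v \<and> sem pol (h_openW 0 v A) w \<Gamma> \<Delta>)"
| "sem pol (HAt A u) w = sem pol A u"
| "sem pol (HDown A) w = sem pol (h_openW 0 w A) w"
  by pat_completeness auto
termination
  by (relation "measure (\<lambda>(pol, A, w). h_size A)") auto

lemma fact_sem: "fact (sem pol A w)"
proof (induction pol A w rule: sem.induct)
  case (1 pol a ts w)
  show ?case
  proof (cases "pol a")
    case True
    then show ?thesis by (simp add: fact_cl)
  next
    case False
    show ?thesis
      unfolding fact_def
    proof (intro conjI allI impI)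
      fix \<Gamma> \<Gamma>' \<Delta> assume "sem pol (HAtom a ts) w \<Gamma> \<Delta>" "ext \<Gamma> \<Gamma>'"
      then show "sem pol (HAtom a ts) w \<Gamma>' \<Delta>" using False by (auto intro: ext_trans)
    next
      fix \<Gamma> \<Delta> assume c: "cl (sem pol (HAtom a ts) w) \<Gamma> \<Delta>"
      \<comment> \<open>The required derivation is itself one of the tests in \<open>cl\<close>: the
        one with empty frame and succedent \<open>Pos (NAtom a ts)\<close> at
        \<open>u\<close>.\<close>
      have "act \<Gamma>' (\<Delta> + {#}) {#} (RP (Pos (NAtom a ts)) u)" if "ext \<Gamma> \<Gamma>'" "weq w u" for \<Gamma>' u
        by (rule clE[OF c that(1)]) (use False that ext_refl ext_finite in auto)
      then show "sem pol (HAtom a ts) w \<Gamma> \<Delta>" using False by simp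
    qed
  qed
next
  case (6 pol w)
  then show ?case by (simp add: fact_def)
qed (simp_all add: fact_cl fact_lolli fact_conj fact_all)

lemma sem_mono: "sem pol A w \<Gamma> \<Delta> \<Longrightarrow> ext \<Gamma> \<Gamma>' \<Longrightarrow> sem pol A w \<Gamma>' \<Delta>"
  by (rule fact_mono[OF fact_sem])

text \<open>\<open>d_lf\<close> may not decide on \<open>Neg (PAtom a ts)\<close>. Such a hypothesis
  enters the model as a generator of the interpretation of its atom.\<close>

lemma sem_atom_hyp: "pol a \<Longrightarrow> sem pol (HAtom a ts) u \<Gamma> {#(Neg (PAtom a ts), u)#}"
  by (auto intro!: cl_unit exI[of _ u] weq_refl)

lemma sem_tensorI: "sem pol A w \<Gamma> \<Delta> \<Longrightarrow> sem pol B w \<Gamma> \<Delta>' \<Longrightarrow> sem pol (HTensor A B) w \<Gamma> (\<Delta> + \<Delta>')"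
  by (simp, rule cl_unit) (auto simp: tensor_def intro: sem_mono)

section \<open>Satisfaction of linear contexts, with one share of the resources per
  hypothesis\<close>

definition sat :: "('a \<Rightarrow> bool) \<Rightarrow> ('a, 'f, 'c::monoid_mult) njdg set
    \<Rightarrow> ('a, 'f, 'c) hjdg multiset \<Rightarrow> ('a, 'f, 'c) njdg multiset \<Rightarrow> bool" where
  "sat pol \<Gamma> M D \<longleftrightarrow> (\<exists>Ds. rel_mset (\<lambda>(A, u) d. sem pol A u \<Gamma> d) M Ds \<and> D = \<Sum>\<^sub># Ds)"

lemma sat_empty [simp]: "sat pol \<Gamma> {#} D \<longleftrightarrow> D = {#}"
  unfolding sat_def by (auto dest: rel_mset_size intro!: exI[of _ "{#}"] simp: rel_mset_Zero)

lemma sat_add: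
  "sat pol \<Gamma> (add_mset (A, u) M) D \<longleftrightarrow> (\<exists>d D'. D = d + D' \<and> sem pol A u \<Gamma> d \<and> sat pol \<Gamma> M D')"
proof
  assume "sat pol \<Gamma> (add_mset (A, u) M) D"
  then obtain Ds where Ds: "rel_mset (\<lambda>(A, u) d. sem pol A u \<Gamma> d) (add_mset (A, u) M) Ds" "D = \<Sum>\<^sub># Ds"
    unfolding sat_def by blast
  from msed_rel_invL[OF Ds(1)] Ds(2)
  show "\<exists>d D'. D = d + D' \<and> sem pol A u \<Gamma> d \<and> sat pol \<Gamma> M D'"
    unfolding sat_def by force
next
  assume "\<exists>d D'. D = d + D' \<and> sem pol A u \<Gamma> d \<and> sat pol \<Gamma> M D'"
  then obtain d Ds where "rel_mset (\<lambda>(A, u) d. sem pol A u \<Gamma> d) M Ds" "D = d + \<Sum>\<^sub># Ds" "sem pol A u \<Gamma> d"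
    unfolding sat_def by blast
  then show "sat pol \<Gamma> (add_mset (A, u) M) D"
    unfolding sat_def by (intro exI[of _ "add_mset d Ds"]) (simp add: rel_mset_Plus)
qed

lemma sat_addI: "sem pol A u \<Gamma> d \<Longrightarrow> sat pol \<Gamma> M D \<Longrightarrow> sat pol \<Gamma> (add_mset (A, u) M) (d + D)"
  unfolding sat_add by blast

lemma sat_union:
  "sat pol \<Gamma> (M + N) D \<longleftrightarrow> (\<exists>D1 D2. D = D1 + D2 \<and> sat pol \<Gamma> M D1 \<and> sat pol \<Gamma> N D2)"
proof (induction M arbitrary: D)
  case empty
  then show ?case by simp
next
  case (add j M)
  obtain A u where "j = (A, u)" by fastforce
  have "sat pol \<Gamma> (add_mset j M + N) D \<longleftrightarrow>
      (\<exists>d D1 D2. D = (d + D1) + D2 \<and> sem pol A u \<Gamma> d \<and> sat pol \<Gamma> M D1 \<and> sat pol \<Gamma> N D2)"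
    unfolding \<open>j = (A, u)\<close> by (simp add: sat_add add.IH add.assoc) blast
  then show ?case
    unfolding \<open>j = (A, u)\<close> by (simp add: sat_add) blast
qed

lemma sat_mono: "sat pol \<Gamma> M D \<Longrightarrow> ext \<Gamma> \<Gamma>' \<Longrightarrow> sat pol \<Gamma>' M D"
proof (induction M arbitrary: D)
  case empty
  then show ?case by simp
next
  case (add j M)
  then show ?case by (cases j) (auto simp: sat_add intro: sem_mono)
qed

section \<open>Soundness of the unfocused calculus\<close>

text \<open>Semantic form of a left rule. The succedent is a fact, so a share known to lie in
  \<open>cl X\<close> may be replaced by an element of \<open>X\<close>, while the other shares move
  to the larger persistent context by monotonicity.\<close>

lemma sat_left:
  assumes "sat pol \<Gamma> (add_mset (A, u) M) D" "finite \<Gamma>"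
    and "\<And>d. sem pol A u \<Gamma> d \<Longrightarrow> cl X \<Gamma> d"
    and "\<And>\<Gamma>' d D'. ext \<Gamma> \<Gamma>' \<Longrightarrow> X \<Gamma>' d \<Longrightarrow> sat pol \<Gamma>' M D' \<Longrightarrow> sem pol C w \<Gamma>' (d + D')"
  shows "sem pol C w \<Gamma> D"
proof -
  from assms(1) obtain d D' where D: "D = d + D'" "sem pol A u \<Gamma> d" "sat pol \<Gamma> M D'"
    by (auto simp: sat_add)
  show ?thesis
    unfolding D(1)
    by (rule cl_bind[OF fact_sem assms(2) assms(3)[OF D(2)]]) (rule assms(4)[OF _ _ sat_mono[OF D(3)]])
qed

section \<open>Validity of unfocused sequents under substitutions\<close>

abbreviation j_subst :: "(nat \<Rightarrow> 'f tm) \<Rightarrow> (nat \<Rightarrow> 'c wexp) \<Rightarrow> ('a, 'f, 'c) hjdg \<Rightarrow> ('a, 'f, 'c) hjdg" where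
  "j_subst \<sigma> \<tau> \<equiv> map_prod (h_subst \<sigma> \<tau>) (w_subst \<tau>)"

text \<open>Persistent hypotheses are satisfied by the empty linear context, so copying one of them
  consumes no resources.\<close>

definition valid_persistent :: "('a \<Rightarrow> bool) \<Rightarrow> (nat \<Rightarrow> 'f tm) \<Rightarrow> (nat \<Rightarrow> 'c::monoid_mult wexp)
    \<Rightarrow> ('a, 'f, 'c) hjdg set \<Rightarrow> ('a, 'f, 'c) njdg set \<Rightarrow> bool" where
  "valid_persistent pol \<sigma> \<tau> \<Gamma> \<Gamma>f \<longleftrightarrow> finite \<Gamma>f \<and>
     (\<forall>A u. (A, u) \<in> \<Gamma> \<longrightarrow> sem pol (h_subst \<sigma> \<tau> A) (w_subst \<tau> u) \<Gamma>f {#})"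

definition valid :: "('a \<Rightarrow> bool) \<Rightarrow> (nat \<Rightarrow> 'f tm) \<Rightarrow> (nat \<Rightarrow> 'c::monoid_mult wexp)
    \<Rightarrow> ('a, 'f, 'c) hjdg set \<Rightarrow> ('a, 'f, 'c) hjdg multiset \<Rightarrow> ('a, 'f, 'c) hprop \<Rightarrow> 'c wexp \<Rightarrow> bool" where
  "valid pol \<sigma> \<tau> \<Gamma> \<Delta> C w \<longleftrightarrow> (\<forall>\<Gamma>f D. valid_persistent pol \<sigma> \<tau> \<Gamma> \<Gamma>f \<longrightarrow>
     sat pol \<Gamma>f (image_mset (j_subst \<sigma> \<tau>) \<Delta>) D \<longrightarrow> sem pol (h_subst \<sigma> \<tau> C) (w_subst \<tau> w) \<Gamma>f D)"

lemma valid_persistent_mono: "valid_persistent pol \<sigma> \<tau> \<Gamma> \<Gamma>f \<Longrightarrow> ext \<Gamma>f \<Gamma>f' \<Longrightarrow> valid_persistent pol \<sigma> \<tau> \<Gamma> \<Gamma>f'"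
  unfolding valid_persistent_def by (auto intro: sem_mono ext_finite)

lemma validI:
  assumes "\<And>\<Gamma>f D. valid_persistent pol \<sigma> \<tau> \<Gamma> \<Gamma>f \<Longrightarrow> finite \<Gamma>f \<Longrightarrow>
     sat pol \<Gamma>f (image_mset (j_subst \<sigma> \<tau>) \<Delta>) D \<Longrightarrow> sem pol (h_subst \<sigma> \<tau> C) (w_subst \<tau> w) \<Gamma>f D"
  shows "valid pol \<sigma> \<tau> \<Gamma> \<Delta> C w"
  using assms unfolding valid_def valid_persistent_def by blast

lemma validD:
  "valid pol \<sigma> \<tau> \<Gamma> \<Delta> C w \<Longrightarrow> valid_persistent pol \<sigma> \<tau> \<Gamma> \<Gamma>f \<Longrightarrow>
     sat pol \<Gamma>f (image_mset (j_subst \<sigma> \<tau>) \<Delta>) D \<Longrightarrow> sem pol (h_subst \<sigma> \<tau> C) (w_subst \<tau> w) \<Gamma>f D"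
  unfolding valid_def by blast

text \<open>Serves the left rules of connectives interpreted by a closure, where \<open>X\<close> is
  the predicate under that closure.\<close>

lemma valid_left:
  assumes "\<And>\<Gamma>f d. finite \<Gamma>f \<Longrightarrow> sem pol (h_subst \<sigma> \<tau> A) (w_subst \<tau> u) \<Gamma>f d \<Longrightarrow> cl X \<Gamma>f d"
    and "\<And>\<Gamma>f d D. valid_persistent pol \<sigma> \<tau> \<Gamma> \<Gamma>f \<Longrightarrow> finite \<Gamma>f \<Longrightarrow> X \<Gamma>f d \<Longrightarrow>
      sat pol \<Gamma>f (image_mset (j_subst \<sigma> \<tau>) \<Delta>) D \<Longrightarrow> sem pol (h_subst \<sigma> \<tau> C) (w_subst \<tau> w) \<Gamma>f (d + D)"
  shows "valid pol \<sigma> \<tau> \<Gamma> (add_mset (A, u) \<Delta>) C w"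
proof (rule validI)
  fix \<Gamma>f D
  assume v: "valid_persistent pol \<sigma> \<tau> \<Gamma> \<Gamma>f" and f: "finite \<Gamma>f"
    and "sat pol \<Gamma>f (image_mset (j_subst \<sigma> \<tau>) (add_mset (A, u) \<Delta>)) D"
  then have s: "sat pol \<Gamma>f (add_mset (h_subst \<sigma> \<tau> A, w_subst \<tau> u) (image_mset (j_subst \<sigma> \<tau>) \<Delta>)) D"
    by simp
  show "sem pol (h_subst \<sigma> \<tau> C) (w_subst \<tau> w) \<Gamma>f D"
    by (rule sat_left[OF s f assms(1)[OF f]])
      (auto intro: assms(2) valid_persistent_mono[OF v] ext_finite)
qed

text \<open>Serves the left rules that trade a hypothesis for one it semantically entails:
  \<open>&\<close>, \<forall>, \<open>at\<close> and \<down>.\<close>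

lemma valid_left_direct:
  assumes "valid pol \<sigma> \<tau> \<Gamma> (add_mset (B, v) \<Delta>) C w"
    and "\<And>\<Gamma>f d. finite \<Gamma>f \<Longrightarrow> sem pol (h_subst \<sigma> \<tau> A) (w_subst \<tau> u) \<Gamma>f d
       \<Longrightarrow> sem pol (h_subst \<sigma> \<tau> B) (w_subst \<tau> v) \<Gamma>f d"
  shows "valid pol \<sigma> \<tau> \<Gamma> (add_mset (A, u) \<Delta>) C w"
proof (rule validI)
  fix \<Gamma>f D
  assume v: "valid_persistent pol \<sigma> \<tau> \<Gamma> \<Gamma>f" and f: "finite \<Gamma>f"
    and "sat pol \<Gamma>f (image_mset (j_subst \<sigma> \<tau>) (add_mset (A, u) \<Delta>)) D"
  then have "sat pol \<Gamma>f (image_mset (j_subst \<sigma> \<tau>) (add_mset (B, v) \<Delta>)) D"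
    using assms(2) by (auto simp: sat_add)
  then show "sem pol (h_subst \<sigma> \<tau> C) (w_subst \<tau> w) \<Gamma>f D"
    by (rule validD[OF assms(1) v])
qed

text \<open>A fresh name does not occur in the contexts, so the eigenvariable can be given any value
  without changing their interpretation.\<close>

lemma valid_updT:
  assumes "x \<notin> hctx_fvT (\<Gamma> \<union> set_mset \<Delta>)"
  shows "valid_persistent pol (\<sigma>(x := t)) \<tau> \<Gamma> \<Gamma>f \<longleftrightarrow> valid_persistent pol \<sigma> \<tau> \<Gamma> \<Gamma>f"
    and "image_mset (j_subst (\<sigma>(x := t)) \<tau>) \<Delta> = image_mset (j_subst \<sigma> \<tau>) \<Delta>"
proof -
  have eq: "h_subst (\<sigma>(x := t)) \<tau> A = h_subst \<sigma> \<tau> A" if "(A, u) \<in> \<Gamma> \<union> set_mset \<Delta>" for A u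
    by (rule h_subst_updT) (use assms that in \<open>auto simp: hctx_fvT_def\<close>)
  show "valid_persistent pol (\<sigma>(x := t)) \<tau> \<Gamma> \<Gamma>f \<longleftrightarrow> valid_persistent pol \<sigma> \<tau> \<Gamma> \<Gamma>f"
    unfolding valid_persistent_def using eq[OF UnI1] by (intro conj_cong all_cong1 imp_cong) simp_all
  show "image_mset (j_subst (\<sigma>(x := t)) \<tau>) \<Delta> = image_mset (j_subst \<sigma> \<tau>) \<Delta>"
  proof (rule image_mset_cong)
    fix j assume "j \<in># \<Delta>"
    then show "j_subst (\<sigma>(x := t)) \<tau> j = j_subst \<sigma> \<tau> j"
      using eq[of "fst j" "snd j"] by (simp add: map_prod_def case_prod_beta)
  qed
qed

lemma valid_updW:
  assumes "x \<notin> hctx_fvW (\<Gamma> \<union> set_mset \<Delta>)"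
  shows "valid_persistent pol \<sigma> (\<tau>(x := v)) \<Gamma> \<Gamma>f \<longleftrightarrow> valid_persistent pol \<sigma> \<tau> \<Gamma> \<Gamma>f"
    and "image_mset (j_subst \<sigma> (\<tau>(x := v))) \<Delta> = image_mset (j_subst \<sigma> \<tau>) \<Delta>"
proof -
  have eq: "h_subst \<sigma> (\<tau>(x := v)) A = h_subst \<sigma> \<tau> A"
    and eq': "w_subst (\<tau>(x := v)) u = w_subst \<tau> u" if "(A, u) \<in> \<Gamma> \<union> set_mset \<Delta>" for A u
    by (rule h_subst_updW w_subst_upd, use assms that in \<open>auto simp: hctx_fvW_def\<close>)+
  show "valid_persistent pol \<sigma> (\<tau>(x := v)) \<Gamma> \<Gamma>f \<longleftrightarrow> valid_persistent pol \<sigma> \<tau> \<Gamma> \<Gamma>f"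
    unfolding valid_persistent_def using eq[OF UnI1] eq'[OF UnI1]
    by (intro conj_cong all_cong1 imp_cong) simp_all
  show "image_mset (j_subst \<sigma> (\<tau>(x := v))) \<Delta> = image_mset (j_subst \<sigma> \<tau>) \<Delta>"
  proof (rule image_mset_cong)
    fix j assume "j \<in># \<Delta>"
    then show "j_subst \<sigma> (\<tau>(x := v)) j = j_subst \<sigma> \<tau> j"
      using eq[of "fst j" "snd j"] eq'[of "fst j" "snd j"] by (simp add: map_prod_def case_prod_beta)
  qed
qed

text \<open>Induction on the derivation with the substitutions left general, so that premises with
  an eigenvariable are available at every value of it. Right rules of positive connectives enter the
  closure by \<open>cl_unit\<close>; left rules go through \<open>valid_left\<close> or
  \<open>valid_left_direct\<close>, except \<multimap>L, which applies the function share to the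
  argument share.\<close>

lemma soundness:
  fixes \<Gamma> :: "('a, 'f, 'c::monoid_mult) hjdg set"
  assumes "useq \<Gamma> \<Delta> C w" "\<forall>x. tm_lc (\<sigma> x)" "\<forall>x. w_lc (\<tau> x)"
  shows "valid pol \<sigma> \<tau> \<Gamma> \<Delta> C w"
  using assms
proof (induction arbitrary: \<sigma> \<tau> rule: useq.induct)
  case (u_init u w \<Gamma> a ts)
  have eq: "weq (w_subst \<tau> u) (w_subst \<tau> w)" by (rule weq_subst[OF u_init(1)])
  show ?case
  proof (rule validI)
    fix \<Gamma>f D
    assume "finite \<Gamma>f" "sat pol \<Gamma>f (image_mset (j_subst \<sigma> \<tau>) {#(HAtom a ts, u)#}) D"
    \<comment> \<open>The two polarities compose the equality on opposite sides: a generator at a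
      world equal to \<open>u\<close> is one at a world equal to \<open>w\<close>, and a test at a
      world equal to \<open>w\<close> is one at a world equal to \<open>u\<close>.\<close>
    then show "sem pol (h_subst \<sigma> \<tau> (HAtom a ts)) (w_subst \<tau> w) \<Gamma>f D"
      using eq weq_trans[OF _ eq] weq_trans[OF eq]
      by (cases "pol a") (auto simp: sat_add intro: cl_bind0[OF fact_cl] cl_unit)
  qed
next
  case (u_copy A u \<Gamma> \<Delta> C w)
  show ?case
  proof (rule validI)
    fix \<Gamma>f D
    assume v: "valid_persistent pol \<sigma> \<tau> \<Gamma> \<Gamma>f" and s: "sat pol \<Gamma>f (image_mset (j_subst \<sigma> \<tau>) \<Delta>) D"
    have "sem pol (h_subst \<sigma> \<tau> A) (w_subst \<tau> u) \<Gamma>f {#}"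
      using v u_copy(1) unfolding valid_persistent_def by blast
    then have "sat pol \<Gamma>f (image_mset (j_subst \<sigma> \<tau>) (add_mset (A, u) \<Delta>)) ({#} + D)"
      using s by (simp only: image_mset_add_mset map_prod_simp sat_addI)
    then show "sem pol (h_subst \<sigma> \<tau> C) (w_subst \<tau> w) \<Gamma>f D"
      using validD[OF u_copy.IH[OF u_copy.prems] v] by simp
  qed
next
  case (u_tensorR \<Gamma> \<Delta>1 A w \<Delta>2 B)
  show ?case
  proof (rule validI)
    fix \<Gamma>f D
    assume v: "valid_persistent pol \<sigma> \<tau> \<Gamma> \<Gamma>f" and "sat pol \<Gamma>f (image_mset (j_subst \<sigma> \<tau>) (\<Delta>1 + \<Delta>2)) D"
    then show "sem pol (h_subst \<sigma> \<tau> (HTensor A B)) (w_subst \<tau> w) \<Gamma>f D"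
      using validD[OF u_tensorR.IH(1)[OF u_tensorR.prems] v] validD[OF u_tensorR.IH(2)[OF u_tensorR.prems] v]
      by (auto simp: sat_union simp del: sem.simps intro: sem_tensorI)
  qed
next
  case (u_tensorL \<Gamma> A u B \<Delta> C w)
  show ?case
  proof (rule valid_left)
    fix \<Gamma>f d D
    assume v: "valid_persistent pol \<sigma> \<tau> \<Gamma> \<Gamma>f"
      and "tensor (sem pol (h_subst \<sigma> \<tau> A) (w_subst \<tau> u)) (sem pol (h_subst \<sigma> \<tau> B) (w_subst \<tau> u)) \<Gamma>f d"
      and s: "sat pol \<Gamma>f (image_mset (j_subst \<sigma> \<tau>) \<Delta>) D"
    then obtain d1 d2 where d: "d = d1 + d2" "sem pol (h_subst \<sigma> \<tau> A) (w_subst \<tau> u) \<Gamma>f d1"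
      "sem pol (h_subst \<sigma> \<tau> B) (w_subst \<tau> u) \<Gamma>f d2"
      unfolding tensor_def by blast
    have "sat pol \<Gamma>f (image_mset (j_subst \<sigma> \<tau>) (add_mset (A, u) (add_mset (B, u) \<Delta>))) (d + D)"
      using sat_addI[OF d(2) sat_addI[OF d(3) s]] d(1) by (simp add: add.assoc)
    then show "sem pol (h_subst \<sigma> \<tau> C) (w_subst \<tau> w) \<Gamma>f (d + D)"
      by (rule validD[OF u_tensorL.IH[OF u_tensorL.prems] v])
  qed simp
next
  case (u_oneR \<Gamma> w)
  show ?case by (rule validI) (auto intro: cl_unit)
next
  case (u_oneL \<Gamma> \<Delta> C w u)
  show ?case
    by (rule valid_left[where X = "\<lambda>\<Gamma> \<Delta>. \<Delta> = {#}"])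
      (use validD[OF u_oneL.IH[OF u_oneL.prems]] in auto)
next
  case (u_lolliR \<Gamma> A w \<Delta> B)
  show ?case
  proof (rule validI)
    fix \<Gamma>f D
    assume v: "valid_persistent pol \<sigma> \<tau> \<Gamma> \<Gamma>f" and s: "sat pol \<Gamma>f (image_mset (j_subst \<sigma> \<tau>) \<Delta>) D"
    show "sem pol (h_subst \<sigma> \<tau> (HLolli A B)) (w_subst \<tau> w) \<Gamma>f D"
      unfolding h_subst.simps sem.simps lolli_def
    proof (intro allI impI)
      fix \<Gamma>' d assume e: "ext \<Gamma>f \<Gamma>'" and d: "sem pol (h_subst \<sigma> \<tau> A) (w_subst \<tau> w) \<Gamma>' d"
      have "sat pol \<Gamma>' (image_mset (j_subst \<sigma> \<tau>) (add_mset (A, w) \<Delta>)) (D + d)"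
        using sat_addI[OF d sat_mono[OF s e]] by (simp add: add.commute)
      then show "sem pol (h_subst \<sigma> \<tau> B) (w_subst \<tau> w) \<Gamma>' (D + d)"
        by (rule validD[OF u_lolliR.IH[OF u_lolliR.prems] valid_persistent_mono[OF v e]])
    qed
  qed
next
  case (u_lolliL \<Gamma> \<Delta>1 A u B \<Delta>2 C w)
  show ?case
  proof (rule validI)
    fix \<Gamma>f D
    assume v: "valid_persistent pol \<sigma> \<tau> \<Gamma> \<Gamma>f" and f: "finite \<Gamma>f"
      and "sat pol \<Gamma>f (image_mset (j_subst \<sigma> \<tau>) (add_mset (HLolli A B, u) (\<Delta>1 + \<Delta>2))) D"
    then obtain d D1 D2 where D: "D = d + (D1 + D2)"
      and d: "lolli (sem pol (h_subst \<sigma> \<tau> A) (w_subst \<tau> u)) (sem pol (h_subst \<sigma> \<tau> B) (w_subst \<tau> u)) \<Gamma>f d"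
      and D1: "sat pol \<Gamma>f (image_mset (j_subst \<sigma> \<tau>) \<Delta>1) D1"
      and D2: "sat pol \<Gamma>f (image_mset (j_subst \<sigma> \<tau>) \<Delta>2) D2"
      by (auto simp: sat_add sat_union)
    have "sem pol (h_subst \<sigma> \<tau> B) (w_subst \<tau> u) \<Gamma>f (d + D1)"
      using d validD[OF u_lolliL.IH(1)[OF u_lolliL.prems] v D1] ext_refl[OF f] unfolding lolli_def by blast
    then have "sat pol \<Gamma>f (image_mset (j_subst \<sigma> \<tau>) (add_mset (B, u) \<Delta>2)) (d + D1 + D2)"
      using sat_addI[OF _ D2] by simp
    then show "sem pol (h_subst \<sigma> \<tau> C) (w_subst \<tau> w) \<Gamma>f D"
      using validD[OF u_lolliL.IH(2)[OF u_lolliL.prems] v] D by (simp add: add.assoc)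
  qed
next
  case (u_withR \<Gamma> \<Delta> A w B)
  then show ?case by (simp add: valid_def)
next
  case (u_withL1 \<Gamma> A u \<Delta> C w B)
  show ?case by (rule valid_left_direct[OF u_withL1.IH[OF u_withL1.prems]]) simp
next
  case (u_withL2 \<Gamma> B u \<Delta> C w A)
  show ?case by (rule valid_left_direct[OF u_withL2.IH[OF u_withL2.prems]]) simp
next
  case (u_topR \<Gamma> \<Delta> w)
  then show ?case by (simp add: valid_def)
next
  case (u_plusR1 \<Gamma> \<Delta> A w B)
  show ?case
    by (rule validI)
      (auto intro!: cl_unit intro: sem_mono validD[OF u_plusR1.IH[OF u_plusR1.prems]])
next
  case (u_plusR2 \<Gamma> \<Delta> B w A)
  show ?case
    by (rule validI)
      (auto intro!: cl_unit intro: sem_mono validD[OF u_plusR2.IH[OF u_plusR2.prems]])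
next
  case (u_plusL \<Gamma> A u \<Delta> C w B)
  show ?case
  proof (rule valid_left)
    fix \<Gamma>f d D
    assume v: "valid_persistent pol \<sigma> \<tau> \<Gamma> \<Gamma>f"
      and "sem pol (h_subst \<sigma> \<tau> A) (w_subst \<tau> u) \<Gamma>f d \<or> sem pol (h_subst \<sigma> \<tau> B) (w_subst \<tau> u) \<Gamma>f d"
        "sat pol \<Gamma>f (image_mset (j_subst \<sigma> \<tau>) \<Delta>) D"
    then show "sem pol (h_subst \<sigma> \<tau> C) (w_subst \<tau> w) \<Gamma>f (d + D)"
      using validD[OF u_plusL.IH(1)[OF u_plusL.prems] v, of "d + D"]
        validD[OF u_plusL.IH(2)[OF u_plusL.prems] v, of "d + D"]
      by (auto intro: sat_addI)
  qed simp
next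
  case (u_zeroL \<Gamma> u \<Delta> C w)
  show ?case by (rule valid_left[where X = "\<lambda>\<Gamma> \<Delta>. False"]) auto
next
  case (u_bangR \<Gamma> A w)
  show ?case
  proof (rule validI)
    fix \<Gamma>f D
    assume v: "valid_persistent pol \<sigma> \<tau> \<Gamma> \<Gamma>f" and s: "sat pol \<Gamma>f (image_mset (j_subst \<sigma> \<tau>) {#}) D"
    have "sem pol (h_subst \<sigma> \<tau> A) (w_subst \<tau> w) \<Gamma>f {#}"
      using validD[OF u_bangR.IH[OF u_bangR.prems] v, of "{#}"] by simp
    then show "sem pol (h_subst \<sigma> \<tau> (HBang A)) (w_subst \<tau> w) \<Gamma>f D"
      using s by (auto intro!: cl_unit intro: sem_mono)
  qed
next
  case (u_bangL A u \<Gamma> \<Delta> C w)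
  show ?case
  proof (rule valid_left)
    fix \<Gamma>f and d D :: "('a, 'f, 'c) njdg multiset"
    assume v: "valid_persistent pol \<sigma> \<tau> \<Gamma> \<Gamma>f"
      and d: "d = {#} \<and> sem pol (h_subst \<sigma> \<tau> A) (w_subst \<tau> u) \<Gamma>f {#}"
      and s: "sat pol \<Gamma>f (image_mset (j_subst \<sigma> \<tau>) \<Delta>) D"
    have "valid_persistent pol \<sigma> \<tau> (insert (A, u) \<Gamma>) \<Gamma>f"
      using v d unfolding valid_persistent_def by auto
    from validD[OF u_bangL.IH[OF u_bangL.prems] this s] d
    show "sem pol (h_subst \<sigma> \<tau> C) (w_subst \<tau> w) \<Gamma>f (d + D)" by simp
  qed simp
next
  case (u_allR_tm x \<Gamma> \<Delta> A w)
  show ?case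
  proof (rule validI)
    fix \<Gamma>f D
    assume v: "valid_persistent pol \<sigma> \<tau> \<Gamma> \<Gamma>f" and s: "sat pol \<Gamma>f (image_mset (j_subst \<sigma> \<tau>) \<Delta>) D"
    have "sem pol (h_openT 0 t (h_subst \<sigma> \<tau> A)) (w_subst \<tau> w) \<Gamma>f D" if t: "tm_lc t" for t
    proof -
      have lc: "\<forall>y. tm_lc ((\<sigma>(x := t)) y)" using u_allR_tm.prems t by simp
      have fresh: "x \<notin> hctx_fvT (\<Gamma> \<union> set_mset \<Delta>)" using u_allR_tm.hyps(1) by simp
      \<comment> \<open>The eigenvariable is made to denote the arbitrary \<open>t\<close>.
        Freshness then removes the update everywhere except at the opened variable.\<close>
      have IH: "valid pol (\<sigma>(x := t)) \<tau> \<Gamma> \<Delta> (h_openT 0 (TFree x) A) w"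
        by (rule u_allR_tm.IH[OF lc u_allR_tm.prems(2)])
      show ?thesis
        using validD[OF IH, of \<Gamma>f D] v s u_allR_tm.hyps(1)
        by (simp add: valid_updT[OF fresh] h_subst_openT[where \<sigma> = "\<sigma>(x := t)", OF lc] h_subst_updT)
    qed
    then show "sem pol (h_subst \<sigma> \<tau> (HAll STm A)) (w_subst \<tau> w) \<Gamma>f D" by simp
  qed
next
  case (u_allR_wd x \<Gamma> \<Delta> A w)
  show ?case
  proof (rule validI)
    fix \<Gamma>f D
    assume v: "valid_persistent pol \<sigma> \<tau> \<Gamma> \<Gamma>f" and s: "sat pol \<Gamma>f (image_mset (j_subst \<sigma> \<tau>) \<Delta>) D"
    have "sem pol (h_openW 0 t (h_subst \<sigma> \<tau> A)) (w_subst \<tau> w) \<Gamma>f D" if t: "w_lc t" for t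
    proof -
      have lc: "\<forall>y. w_lc ((\<tau>(x := t)) y)" using u_allR_wd.prems t by simp
      have fresh: "x \<notin> hctx_fvW (\<Gamma> \<union> set_mset \<Delta>)" using u_allR_wd.hyps(1) by simp
      have IH: "valid pol \<sigma> (\<tau>(x := t)) \<Gamma> \<Delta> (h_openW 0 (WFree x) A) w"
        by (rule u_allR_wd.IH[OF u_allR_wd.prems(1) lc])
      show ?thesis
        using validD[OF IH, of \<Gamma>f D] v s u_allR_wd.hyps(1)
        by (simp add: valid_updW[OF fresh] h_subst_openW[where \<tau> = "\<tau>(x := t)", OF lc] h_subst_updW w_subst_upd)
    qed
    then show "sem pol (h_subst \<sigma> \<tau> (HAll SWd A)) (w_subst \<tau> w) \<Gamma>f D" by simp
  qed
next
  case (u_allL_tm t \<Gamma> A u \<Delta> C w)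
  show ?case
    by (rule valid_left_direct[OF u_allL_tm.IH[OF u_allL_tm.prems]])
      (use u_allL_tm in \<open>simp add: h_subst_openT tm_subst_lc\<close>)
next
  case (u_allL_wd v \<Gamma> A u \<Delta> C w)
  show ?case
    by (rule valid_left_direct[OF u_allL_wd.IH[OF u_allL_wd.prems]])
      (use u_allL_wd in \<open>simp add: h_subst_openW w_subst_lc\<close>)
next
  case (u_exR_tm t \<Gamma> \<Delta> A w)
  have "tm_lc (tm_subst \<sigma> t)" using u_exR_tm by (simp add: tm_subst_lc)
  then show ?case
    using validD[OF u_exR_tm.IH[OF u_exR_tm.prems]]
    by (intro validI) (auto simp: h_subst_openT[OF u_exR_tm.prems(1)] intro!: cl_unit intro: sem_mono)
next
  case (u_exR_wd v \<Gamma> \<Delta> A w)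
  have "w_lc (w_subst \<tau> v)" using u_exR_wd by (simp add: w_subst_lc)
  then show ?case
    using validD[OF u_exR_wd.IH[OF u_exR_wd.prems]]
    by (intro validI) (auto simp: h_subst_openW[OF u_exR_wd.prems(2)] intro!: cl_unit intro: sem_mono)
next
  case (u_exL_tm x \<Gamma> \<Delta> A C u w)
  show ?case
  proof (rule valid_left)
    fix \<Gamma>f d D
    assume v: "valid_persistent pol \<sigma> \<tau> \<Gamma> \<Gamma>f"
      and "\<exists>t. tm_lc t \<and> sem pol (h_openT 0 t (h_subst \<sigma> \<tau> A)) (w_subst \<tau> u) \<Gamma>f d"
      and s: "sat pol \<Gamma>f (image_mset (j_subst \<sigma> \<tau>) \<Delta>) D"
    then obtain t where t: "tm_lc t"
      and d: "sem pol (h_openT 0 t (h_subst \<sigma> \<tau> A)) (w_subst \<tau> u) \<Gamma>f d" by blast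
    have lc: "\<forall>y. tm_lc ((\<sigma>(x := t)) y)" using u_exL_tm.prems t by simp
    have fresh: "x \<notin> hctx_fvT (\<Gamma> \<union> set_mset \<Delta>)" using u_exL_tm.hyps(1) by simp
    \<comment> \<open>The witness \<open>t\<close> obtained from the generator becomes the value of
      the eigenvariable; by freshness the succedent \<open>C\<close> keeps its
      interpretation.\<close>
    have IH: "valid pol (\<sigma>(x := t)) \<tau> \<Gamma> (add_mset (h_openT 0 (TFree x) A, u) \<Delta>) C w"
      by (rule u_exL_tm.IH[OF lc u_exL_tm.prems(2)])
    have "sat pol \<Gamma>f (image_mset (j_subst (\<sigma>(x := t)) \<tau>) (add_mset (h_openT 0 (TFree x) A, u) \<Delta>)) (d + D)"
      using d s u_exL_tm.hyps(1) by (auto simp: valid_updT[OF fresh] h_subst_openT[where \<sigma> = "\<sigma>(x := t)", OF lc] h_subst_updT intro: sat_addI)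
    from validD[OF IH _ this] v u_exL_tm.hyps(1)
    show "sem pol (h_subst \<sigma> \<tau> C) (w_subst \<tau> w) \<Gamma>f (d + D)"
      by (simp add: valid_updT[OF fresh] h_subst_updT)
  qed simp
next
  case (u_exL_wd x \<Gamma> \<Delta> A u C w)
  show ?case
  proof (rule valid_left)
    fix \<Gamma>f d D
    assume v: "valid_persistent pol \<sigma> \<tau> \<Gamma> \<Gamma>f"
      and "\<exists>t. w_lc t \<and> sem pol (h_openW 0 t (h_subst \<sigma> \<tau> A)) (w_subst \<tau> u) \<Gamma>f d"
      and s: "sat pol \<Gamma>f (image_mset (j_subst \<sigma> \<tau>) \<Delta>) D"
    then obtain t where t: "w_lc t"
      and d: "sem pol (h_openW 0 t (h_subst \<sigma> \<tau> A)) (w_subst \<tau> u) \<Gamma>f d" by blast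
    have lc: "\<forall>y. w_lc ((\<tau>(x := t)) y)" using u_exL_wd.prems t by simp
    have fresh: "x \<notin> hctx_fvW (\<Gamma> \<union> set_mset \<Delta>)" using u_exL_wd.hyps(1) by simp
    have IH: "valid pol \<sigma> (\<tau>(x := t)) \<Gamma> (add_mset (h_openW 0 (WFree x) A, u) \<Delta>) C w"
      by (rule u_exL_wd.IH[OF u_exL_wd.prems(1) lc])
    have "sat pol \<Gamma>f (image_mset (j_subst \<sigma> (\<tau>(x := t))) (add_mset (h_openW 0 (WFree x) A, u) \<Delta>)) (d + D)"
      using d s u_exL_wd.hyps(1)
      by (auto simp: valid_updW[OF fresh] h_subst_openW[where \<tau> = "\<tau>(x := t)", OF lc] h_subst_updW w_subst_upd intro: sat_addI)
    from validD[OF IH _ this] v u_exL_wd.hyps(1)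
    show "sem pol (h_subst \<sigma> \<tau> C) (w_subst \<tau> w) \<Gamma>f (d + D)"
      by (simp add: valid_updW[OF fresh] h_subst_updW w_subst_upd)
  qed simp
next
  case (u_atR \<Gamma> \<Delta> A u v)
  then show ?case by (simp add: valid_def)
next
  case (u_atL \<Gamma> A u \<Delta> C w v)
  show ?case by (rule valid_left_direct[OF u_atL.IH[OF u_atL.prems]]) simp
next
  case (u_downR \<Gamma> \<Delta> w A)
  then show ?case by (simp add: valid_def h_subst_openW)
next
  case (u_downL \<Gamma> v A \<Delta> C w)
  show ?case
    by (rule valid_left_direct[OF u_downL.IH[OF u_downL.prems]])
      (use u_downL.prems in \<open>simp add: h_subst_openW\<close>)
qed

text \<open>Iterates !L over the finite set \<Gamma>. The set \<open>\<Gamma>0\<close> is general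
  because each step hands one more judgement to it before the induction hypothesis is used. With
  \<open>\<Gamma>0\<close> empty all hypotheses become linear, as in the sequent to be
  focused.\<close>

lemma useq_bang:
  assumes "finite \<Gamma>" "useq (\<Gamma> \<union> \<Gamma>0) \<Delta> C w"
  shows "useq \<Gamma>0 (image_mset (\<lambda>(A, u). (HBang A, u)) (mset_set \<Gamma>) + \<Delta>) C w"
  using assms
proof (induction \<Gamma> arbitrary: \<Gamma>0)
  case empty
  then show ?case by simp
next
  case (insert j \<Gamma>)
  obtain A u where j: "j = (A, u)" by fastforce
  have "useq (insert (A, u) \<Gamma>0) (image_mset (\<lambda>(A, u). (HBang A, u)) (mset_set \<Gamma>) + \<Delta>) C w"
    by (rule insert.IH) (use insert.prems j in simp)
  from u_bangL[OF this] show ?case using insert.hyps j by simp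
qed

section \<open>Adequacy of the model for the focused calculus\<close>

text \<open>The contexts that can stand in for a focused \<open>N\<close>: they turn any derivation
  with left focus on \<open>N\<close> into a stable derivation.\<close>

definition lfoc_pred :: "('a, 'f, 'c::monoid_mult) nprop \<Rightarrow> 'c wexp \<Rightarrow> ('a, 'f, 'c) ctxpred" where
  "lfoc_pred N u \<Gamma> \<Delta> \<longleftrightarrow> (\<forall>\<Gamma>' \<Xi> Q w. ext \<Gamma> \<Gamma>' \<longrightarrow> lfoc \<Gamma>' \<Xi> N u Q w \<longrightarrow> act \<Gamma>' (\<Delta> + \<Xi>) {#} (RP Q w))"

text \<open>The quantification over extensions makes the predicate monotone by construction.\<close>

definition rfoc_pred :: "('a, 'f, 'c::monoid_mult) pprop \<Rightarrow> 'c wexp \<Rightarrow> ('a, 'f, 'c) ctxpred" where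
  "rfoc_pred P w \<Gamma> \<Delta> \<longleftrightarrow> (\<forall>\<Gamma>'. ext \<Gamma> \<Gamma>' \<longrightarrow> rfoc \<Gamma>' \<Delta> P w)"

primrec holds :: "('a \<Rightarrow> bool) \<Rightarrow> ('a, 'f, 'c::monoid_mult) rhs \<Rightarrow> ('a, 'f, 'c) ctxpred" where
  "holds pol (RP Q w) = (\<lambda>\<Gamma> \<Delta>. act \<Gamma> \<Delta> {#} (RP Q w))"
| "holds pol (RN N w) = sem pol (eraseN N) w"

text \<open>A positive right-hand side is carried along unchanged while the positive hypotheses are
  decomposed, hence its weight 0. Thus the sequent with \<open>P\<close> alone in \<Omega> and
  \<open>RP Q w\<close> on the right is smaller than \<open>Neg P\<close>, however large
  \<open>Q\<close> is.\<close>

primrec rhs_size :: "('a, 'f, 'c) rhs \<Rightarrow> nat" where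
  "rhs_size (RP Q w) = 0"
| "rhs_size (RN N w) = n_size N"

primrec rhs_ok :: "('a \<Rightarrow> bool) \<Rightarrow> ('a, 'f, 'c) rhs \<Rightarrow> bool" where
  "rhs_ok pol (RP Q w) = True"
| "rhs_ok pol (RN N w) = polokN pol N"

abbreviation erase_ctx :: "('a, 'f, 'c) pjdg multiset \<Rightarrow> ('a, 'f, 'c) hjdg multiset" where
  "erase_ctx \<equiv> image_mset (map_prod eraseP id)"

definition act_size :: "('a, 'f, 'c) pjdg multiset \<Rightarrow> ('a, 'f, 'c) rhs \<Rightarrow> nat" where
  "act_size \<Omega> R = (\<Sum>(P, u)\<in>#\<Omega>. p_size P) + rhs_size R"

lemma act_size_simps [simp]:
  "act_size {#} R = rhs_size R"
  "act_size (add_mset (P, u) \<Omega>) R = p_size P + act_size \<Omega> R"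
  by (simp_all add: act_size_def)

definition ctx_ok :: "('a \<Rightarrow> bool) \<Rightarrow> ('a, 'f, 'c) pjdg multiset \<Rightarrow> bool" where
  "ctx_ok pol \<Omega> \<longleftrightarrow> (\<forall>(P, u)\<in>#\<Omega>. polokP pol P)"

lemma ctx_ok_simps [simp]:
  "ctx_ok pol {#}"
  "ctx_ok pol (add_mset (P, u) \<Omega>) \<longleftrightarrow> polokP pol P \<and> ctx_ok pol \<Omega>"
  "ctx_ok pol (\<Omega> + \<Omega>') \<longleftrightarrow> ctx_ok pol \<Omega> \<and> ctx_ok pol \<Omega>'"
  by (auto simp: ctx_ok_def)

definition act_adequate :: "('a \<Rightarrow> bool) \<Rightarrow> ('a, 'f, 'c::monoid_mult) pjdg multiset \<Rightarrow> ('a, 'f, 'c) rhs \<Rightarrow> bool" where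
  "act_adequate pol \<Omega> R \<longleftrightarrow> (\<forall>\<Gamma> \<Delta>. finite \<Gamma> \<longrightarrow>
     (\<forall>\<Gamma>' D. ext \<Gamma> \<Gamma>' \<longrightarrow> sat pol \<Gamma>' (erase_ctx \<Omega>) D \<longrightarrow> holds pol R \<Gamma>' (\<Delta> + D)) \<longrightarrow> act \<Gamma> \<Delta> \<Omega> R)"

definition n_adequate :: "('a \<Rightarrow> bool) \<Rightarrow> ('a, 'f, 'c::monoid_mult) nprop \<Rightarrow> 'c wexp \<Rightarrow> bool" where
  "n_adequate pol N u \<longleftrightarrow> (\<forall>\<Gamma> \<Delta>. finite \<Gamma> \<longrightarrow> lfoc_pred N u \<Gamma> \<Delta> \<longrightarrow> sem pol (eraseN N) u \<Gamma> \<Delta>)"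

text \<open>Only the closure is reached: the context itself may have to pass through stable phases
  before \<open>P\<close> can be focused on.\<close>

definition p_adequate :: "('a \<Rightarrow> bool) \<Rightarrow> ('a, 'f, 'c::monoid_mult) pprop \<Rightarrow> 'c wexp \<Rightarrow> bool" where
  "p_adequate pol P w \<longleftrightarrow> (\<forall>\<Gamma> \<Delta>. finite \<Gamma> \<longrightarrow> sem pol (eraseP P) w \<Gamma> \<Delta> \<longrightarrow> cl (rfoc_pred P w) \<Gamma> \<Delta>)"

lemma act_adequateD:
  "act_adequate pol \<Omega> R \<Longrightarrow> finite \<Gamma> \<Longrightarrow>
     (\<And>\<Gamma>' D. ext \<Gamma> \<Gamma>' \<Longrightarrow> sat pol \<Gamma>' (erase_ctx \<Omega>) D \<Longrightarrow> holds pol R \<Gamma>' (\<Delta> + D)) \<Longrightarrow> act \<Gamma> \<Delta> \<Omega> R"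
  unfolding act_adequate_def by blast

lemma n_adequateD: "n_adequate pol N u \<Longrightarrow> finite \<Gamma> \<Longrightarrow> lfoc_pred N u \<Gamma> \<Delta> \<Longrightarrow> sem pol (eraseN N) u \<Gamma> \<Delta>"
  unfolding n_adequate_def by blast

lemma p_adequateD: "p_adequate pol P w \<Longrightarrow> finite \<Gamma> \<Longrightarrow> sem pol (eraseP P) w \<Gamma> \<Delta> \<Longrightarrow> cl (rfoc_pred P w) \<Gamma> \<Delta>"
  unfolding p_adequate_def by blast

section \<open>Focus predicates and the decision rules\<close>

lemma rfoc_pred_mono: "rfoc_pred P w \<Gamma> \<Delta> \<Longrightarrow> ext \<Gamma> \<Gamma>' \<Longrightarrow> rfoc_pred P w \<Gamma>' \<Delta>"
  unfolding rfoc_pred_def using ext_trans by blast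

lemma rfoc_pred_weaken:
  assumes "cl (rfoc_pred P w) \<Gamma> \<Delta>" "finite \<Gamma>" "\<And>\<Gamma>' \<Delta>'. rfoc \<Gamma>' \<Delta>' P w \<Longrightarrow> rfoc \<Gamma>' \<Delta>' P' w'"
  shows "cl (rfoc_pred P' w') \<Gamma> \<Delta>"
  by (rule cl_bind0[OF fact_cl assms(2,1)], rule cl_unit)
    (auto simp: rfoc_pred_def intro: assms(3) ext_trans)

lemma lfoc_predD:
  "lfoc_pred N u \<Gamma> \<Delta> \<Longrightarrow> ext \<Gamma> \<Gamma>' \<Longrightarrow> lfoc \<Gamma>' \<Xi> N u Q w \<Longrightarrow> act \<Gamma>' (\<Delta> + \<Xi>) {#} (RP Q w)"
  unfolding lfoc_pred_def by blast

lemma lfoc_pred_weaken: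
  "lfoc_pred N u \<Gamma> \<Delta> \<Longrightarrow> (\<And>\<Gamma>' \<Delta>' Q w. lfoc \<Gamma>' \<Delta>' N' u' Q w \<Longrightarrow> lfoc \<Gamma>' \<Delta>' N u Q w) \<Longrightarrow> lfoc_pred N' u' \<Gamma> \<Delta>"
  unfolding lfoc_pred_def by blast

text \<open>The closure is tested with the empty frame and succedent \<open>P\<close> at
  \<open>w\<close>; every covering context passes this test by \<open>d_rf\<close>, whose side
  condition is the assumption on \<open>P\<close>.\<close>

lemma stable_of_cl_rfoc_pred:
  assumes "cl (rfoc_pred P w) \<Gamma> \<Delta>" "finite \<Gamma>" "\<forall>n ts. P \<noteq> Pos (NAtom n ts)"
  shows "act \<Gamma> \<Delta> {#} (RP P w)"
proof -
  have "act \<Gamma> (\<Delta> + {#}) {#} (RP P w)"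
    by (rule clE[OF assms(1) ext_refl[OF assms(2)]])
      (use assms(3) in \<open>auto simp: rfoc_pred_def intro: d_rf ext_refl ext_finite\<close>)
  then show ?thesis by simp
qed

text \<open>The judgement survives in every extension, where \<open>d_cplf\<close> decides on it
  without consuming linear resources.\<close>

lemma lfoc_pred_persistent: "(N, u) \<in> \<Gamma> \<Longrightarrow> lfoc_pred N u \<Gamma> {#}"
  unfolding lfoc_pred_def ext_def by (auto intro: d_cplf)

lemma lfoc_pred_linear: "\<forall>p ts. N \<noteq> Neg (PAtom p ts) \<Longrightarrow> lfoc_pred N u \<Gamma> {#(N, u)#}"
  unfolding lfoc_pred_def by (auto intro: d_lf)

text \<open>This is the inversion phase read upwards: while \<Omega> is nonempty one positive
  hypothesis is decomposed, and then the right-hand side. The semantic assumption for the conclusion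
  yields that of each premise, at smaller total size. \<open>IHn\<close> serves hypotheses leaving
  \<Omega> through \<open>PBang\<close> or \<open>Pos\<close>; \<open>IHp\<close> serves the end of
  the phase, when \<open>Neg P\<close> leaves a positive goal.\<close>

lemma act_adequate_step:
  fixes \<Omega> :: "('a, 'f, 'c::monoid_mult) pjdg multiset"
  assumes IHa: "\<And>\<Omega>' (R' :: ('a, 'f, 'c) rhs). act_size \<Omega>' R' < act_size \<Omega> R \<Longrightarrow> ctx_ok pol \<Omega>' \<Longrightarrow> rhs_ok pol R' \<Longrightarrow> act_adequate pol \<Omega>' R'"
    and IHn: "\<And>(N :: ('a, 'f, 'c) nprop) u. n_size N < act_size \<Omega> R \<Longrightarrow> polokN pol N \<Longrightarrow> n_adequate pol N u"
    and IHp: "\<And>(P :: ('a, 'f, 'c) pprop) u. p_size P < act_size \<Omega> R \<Longrightarrow> polokP pol P \<Longrightarrow> p_adequate pol P u"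
    and ok: "ctx_ok pol \<Omega>" "rhs_ok pol R"
  shows "act_adequate pol \<Omega> R"
  unfolding act_adequate_def
proof (intro allI impI)
  fix \<Gamma> \<Delta>
  assume fin: "finite \<Gamma>"
    and H0: "\<forall>\<Gamma>' D. ext \<Gamma> \<Gamma>' \<longrightarrow> sat pol \<Gamma>' (erase_ctx \<Omega>) D \<longrightarrow> holds pol R \<Gamma>' (\<Delta> + D)"
  show "act \<Gamma> \<Delta> \<Omega> R"
  proof (cases \<Omega>)
    case empty
    have H: "holds pol R \<Gamma>' \<Delta>" if "ext \<Gamma> \<Gamma>'" for \<Gamma>'
      using H0 that empty by force
    have sub: "act \<Gamma> \<Delta> \<Omega>' R'"
      if "act_size \<Omega>' R' < act_size \<Omega> R" "ctx_ok pol \<Omega>'" "rhs_ok pol R'"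
        and "\<And>\<Gamma>' D. ext \<Gamma> \<Gamma>' \<Longrightarrow> sat pol \<Gamma>' (erase_ctx \<Omega>') D \<Longrightarrow> holds pol R' \<Gamma>' (\<Delta> + D)" for \<Omega>' R'
      by (rule act_adequateD[OF IHa[OF that(1-3)] fin that(4)])
    show ?thesis
    proof (cases R)
      case (RP Q w)
      then show ?thesis using H[OF ext_refl[OF fin]] empty by simp
    next
      case (RN N w)
      have sem: "sem pol (eraseN N) w \<Gamma>' \<Delta>" if "ext \<Gamma> \<Gamma>'" for \<Gamma>' using H[OF that] RN by simp
      show ?thesis
      proof (cases N)
        case (NAtom a ts)
        then have "act \<Gamma> \<Delta> {#} (RP (Pos (NAtom a ts)) w)"
          using sem[OF ext_refl[OF fin]] ok RN by (simp add: ext_refl[OF fin] weq_refl)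
        then show ?thesis unfolding RN NAtom empty by (rule a_rp)
      next
        case (NWith M1 M2)
        have "act \<Gamma> \<Delta> {#} (RN M1 w)" "act \<Gamma> \<Delta> {#} (RN M2 w)"
          by (rule sub; use sem ok RN NWith empty in simp)+
        then show ?thesis unfolding RN NWith empty by (rule a_withR)
      next
        case NTop
        show ?thesis unfolding RN NTop by (rule a_topR)
      next
        case (NLolli P M)
        have "act \<Gamma> \<Delta> {#(P, w)#} (RN M w)"
        proof (rule sub)
          fix \<Gamma>' D assume e: "ext \<Gamma> \<Gamma>'" and "sat pol \<Gamma>' (erase_ctx {#(P, w)#}) D"
          then have "sem pol (eraseP P) w \<Gamma>' D" by (auto simp: sat_add)
          then show "holds pol (RN M w) \<Gamma>' (\<Delta> + D)"
            using sem[OF e] ext_refl[OF ext_finite[OF e]] NLolli by (simp add: lolli_def)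
        qed (use ok RN NLolli empty in simp_all)
        then show ?thesis unfolding RN NLolli empty by (rule a_lolliR)
      next
        case (NAll s M)
        show ?thesis
        proof (cases s)
          case STm
          \<comment> \<open>Finiteness of \<Gamma> provides the eigenvariable, and the premise is
            the instance of the semantic universal at \<open>TFree x\<close>.\<close>
          obtain x where x: "x \<notin> fctx_fvT \<Gamma> \<Delta> \<Omega> \<union> n_fvT M"
            using fresh_nat fin by (metis finite_UnI finite_fctx_fvT finite_fvT(2))
          have "act \<Gamma> \<Delta> {#} (RN (n_openT 0 (TFree x) M) w)"
            by (rule sub; use sem ok RN NAll STm empty in \<open>simp add: erase_openT polok_openT\<close>)
          with x show ?thesis unfolding RN NAll STm empty by (rule a_allR_tm)
        next
          case SWd
          obtain x where x: "x \<notin> fctx_fvW \<Gamma> \<Delta> \<Omega> \<union> n_fvW M \<union> w_fv w"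
            using fresh_nat fin by (metis finite_UnI finite_fctx_fvW finite_fvW(2) finite_w_fv)
          have "act \<Gamma> \<Delta> {#} (RN (n_openW 0 (WFree x) M) w)"
            by (rule sub; use sem ok RN NAll SWd empty in \<open>simp add: erase_openW polok_openW\<close>)
          with x show ?thesis unfolding RN NAll SWd empty by (rule a_allR_wd)
        qed
      next
        case (NDown M)
        have "act \<Gamma> \<Delta> {#} (RN (n_openW 0 w M) w)"
          by (rule sub; use sem ok RN NDown empty in \<open>simp add: erase_openW polok_openW\<close>)
        then show ?thesis unfolding RN NDown empty by (rule a_downRA)
      next
        case (NAt M v)
        have "act \<Gamma> \<Delta> {#} (RN M v)"
          by (rule sub; use sem ok RN NAt empty in simp)
        then show ?thesis unfolding RN NAt empty by (rule a_atRA)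
      next
        case (Neg P)
        have P: "sem pol (eraseP P) w \<Gamma> \<Delta>" using sem[OF ext_refl[OF fin]] Neg by simp
        have "act \<Gamma> \<Delta> {#} (RP P w)"
        \<comment> \<open>\<open>d_rf\<close> excludes \<open>Pos (NAtom n ts)\<close>. In that case
          \<open>P\<close> erases to a negative atom, whose interpretation already is the required
          stable derivation.\<close>
        proof (cases "\<forall>n ts. P \<noteq> Pos (NAtom n ts)")
          case True
          have "cl (rfoc_pred P w) \<Gamma> \<Delta>"
            by (rule p_adequateD[OF IHp fin P]) (use ok RN Neg empty in simp_all)
          then show ?thesis using fin True by (rule stable_of_cl_rfoc_pred)
        next
          case False
          then show ?thesis
            using P ok RN Neg by (auto simp: ext_refl[OF fin] weq_refl)
        qed
        then show ?thesis unfolding RN Neg empty by (rule a_negR)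
      qed
    qed
  next
    case (add j \<Omega>')
    obtain P u where j: "j = (P, u)" by fastforce
    have Om: "\<Omega> = add_mset (P, u) \<Omega>'" using add j by simp
    have H: "holds pol R \<Gamma>' (\<Delta> + (d + D))"
      if "ext \<Gamma> \<Gamma>'" "sem pol (eraseP P) u \<Gamma>' d" "sat pol \<Gamma>' (erase_ctx \<Omega>') D" for \<Gamma>' d D
      using H0 that by (simp add: Om sat_addI)
    have sub: "act \<Gamma>0 \<Delta>0 \<Omega>0 R"
      if "act_size \<Omega>0 R < act_size \<Omega> R" "ctx_ok pol \<Omega>0" "finite \<Gamma>0"
        and "\<And>\<Gamma>' D. ext \<Gamma>0 \<Gamma>' \<Longrightarrow> sat pol \<Gamma>' (erase_ctx \<Omega>0) D \<Longrightarrow> holds pol R \<Gamma>' (\<Delta>0 + D)" for \<Gamma>0 \<Delta>0 \<Omega>0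
      by (rule act_adequateD[OF IHa[OF that(1,2) ok(2)] that(3,4)])
    \<comment> \<open>Covers the rules that replace one hypothesis by one smaller hypothesis: it
      suffices that every share for the new judgement is also a share for the old one.\<close>
    have repl: "act \<Gamma> \<Delta> (add_mset (P', u') \<Omega>') R"
      if "p_size P' < p_size P" "polokP pol P'"
        and "\<And>\<Gamma>' d. ext \<Gamma> \<Gamma>' \<Longrightarrow> sem pol (eraseP P') u' \<Gamma>' d \<Longrightarrow> sem pol (eraseP P) u \<Gamma>' d" for P' u'
    proof (rule sub)
      fix \<Gamma>' D assume "ext \<Gamma> \<Gamma>'" "sat pol \<Gamma>' (erase_ctx (add_mset (P', u') \<Omega>')) D"
      then show "holds pol R \<Gamma>' (\<Delta> + D)" using that(3) H by (auto simp: sat_add)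
    qed (use that(1,2) ok fin Om in simp_all)
    show ?thesis
    proof (cases P)
      case (PAtom a ts)
      have "act \<Gamma> (add_mset (Neg (PAtom a ts), u) \<Delta>) \<Omega>' R"
      proof (rule sub)
        fix \<Gamma>' D assume e: "ext \<Gamma> \<Gamma>'" and D: "sat pol \<Gamma>' (erase_ctx \<Omega>') D"
        have "sem pol (eraseP P) u \<Gamma>' {#(Neg (PAtom a ts), u)#}"
          using ok Om PAtom by (simp add: sem_atom_hyp del: sem.simps)
        from H[OF e this D] show "holds pol R \<Gamma>' (add_mset (Neg (PAtom a ts), u) \<Delta> + D)" by simp
      qed (use ok fin Om PAtom in simp_all)
      then show ?thesis unfolding Om PAtom by (rule a_lp)
    next
      case (PTensor P1 P2)
      have "act \<Gamma> \<Delta> (add_mset (P1, u) (add_mset (P2, u) \<Omega>')) R"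
      proof (rule sub)
        fix \<Gamma>' D assume e: "ext \<Gamma> \<Gamma>'"
          and "sat pol \<Gamma>' (erase_ctx (add_mset (P1, u) (add_mset (P2, u) \<Omega>'))) D"
        then obtain d1 d2 D' where D: "D = (d1 + d2) + D'" "sem pol (eraseP P1) u \<Gamma>' d1"
          "sem pol (eraseP P2) u \<Gamma>' d2" "sat pol \<Gamma>' (erase_ctx \<Omega>') D'"
          by (auto simp: sat_add add.assoc)
        show "holds pol R \<Gamma>' (\<Delta> + D)"
          unfolding D(1) by (rule H[OF e _ D(4)]) (use sem_tensorI[OF D(2,3)] PTensor in simp)
      qed (use ok fin Om PTensor in simp_all)
      then show ?thesis unfolding Om PTensor by (rule a_tensorL)
    next
      case POne
      have "act \<Gamma> \<Delta> \<Omega>' R"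
      proof (rule sub)
        fix \<Gamma>' D assume e: "ext \<Gamma> \<Gamma>'" and D: "sat pol \<Gamma>' (erase_ctx \<Omega>') D"
        have "sem pol (eraseP P) u \<Gamma>' {#}" using POne by (simp add: cl_unit)
        from H[OF e this D] show "holds pol R \<Gamma>' (\<Delta> + D)" by simp
      qed (use ok fin Om POne in simp_all)
      then show ?thesis unfolding Om POne by (rule a_oneL)
    next
      case (PPlus P1 P2)
      have "act \<Gamma> \<Delta> (add_mset (P1, u) \<Omega>') R" "act \<Gamma> \<Delta> (add_mset (P2, u) \<Omega>') R"
        by (rule repl; use ok Om PPlus in \<open>auto intro!: cl_unit intro: sem_mono\<close>)+
      then show ?thesis unfolding Om PPlus by (rule a_plusL)
    next
      case PZero
      show ?thesis unfolding Om PZero by (rule a_zeroL)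
    next
      case (PBang N)
      \<comment> \<open>Over any extension of the enlarged persistent context, \<open>N\<close> can
        be focused on from no linear resources. Adequacy of \<open>N\<close> therefore makes the
        empty multiset a share for \<open>PBang N\<close>.\<close>
      have "act (insert (N, u) \<Gamma>) \<Delta> \<Omega>' R"
      proof (rule sub)
        fix \<Gamma>' D assume e: "ext (insert (N, u) \<Gamma>) \<Gamma>'" and D: "sat pol \<Gamma>' (erase_ctx \<Omega>') D"
        have e': "ext \<Gamma> \<Gamma>'" using e by (simp add: ext_def)
        have n: "n_adequate pol N u" by (rule IHn) (use ok Om PBang in simp_all)
        have "sem pol (eraseP P) u \<Gamma>' {#}"
          using PBang e by (auto intro!: cl_unit n_adequateD[OF n] lfoc_pred_persistent simp: ext_def)
        from H[OF e' this D] show "holds pol R \<Gamma>' (\<Delta> + D)" by simp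
      qed (use ok fin Om PBang in simp_all)
      then show ?thesis unfolding Om PBang by (rule a_bangL)
    next
      case (PEx s P')
      show ?thesis
      proof (cases s)
        case STm
        obtain x where x: "x \<notin> fctx_fvT \<Gamma> \<Delta> \<Omega>' \<union> p_fvT P' \<union> rhs_fvT R"
          using fresh_nat fin by (metis finite_UnI finite_fctx_fvT finite_fvT(1) finite_rhs_fv(1))
        have "act \<Gamma> \<Delta> (add_mset (p_openT 0 (TFree x) P', u) \<Omega>') R"
          by (rule repl; use ok Om PEx STm in
            \<open>auto simp: erase_openT polok_openT intro!: cl_unit exI[of _ "TFree x"] intro: sem_mono\<close>)
        with x show ?thesis unfolding Om PEx STm by (rule a_exL_tm)
      next
        case SWd
        obtain x where x: "x \<notin> fctx_fvW \<Gamma> \<Delta> \<Omega>' \<union> p_fvW P' \<union> w_fv u \<union> rhs_fvW R"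
          using fresh_nat fin by (metis finite_UnI finite_fctx_fvW finite_fvW(1) finite_rhs_fv(2) finite_w_fv)
        have "act \<Gamma> \<Delta> (add_mset (p_openW 0 (WFree x) P', u) \<Omega>') R"
          by (rule repl; use ok Om PEx SWd in
            \<open>auto simp: erase_openW polok_openW intro!: cl_unit exI[of _ "WFree x"] intro: sem_mono\<close>)
        with x show ?thesis unfolding Om PEx SWd by (rule a_exL_wd)
      qed
    next
      case (PDown P')
      have "act \<Gamma> \<Delta> (add_mset (p_openW 0 u P', u) \<Omega>') R"
        by (rule repl; use ok Om PDown in \<open>simp add: erase_openW polok_openW\<close>)
      then show ?thesis unfolding Om PDown by (rule a_downLA)
    next
      case (PAt P' v)
      have "act \<Gamma> \<Delta> (add_mset (P', v) \<Omega>') R"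
        by (rule repl; use ok Om PAt in simp)
      then show ?thesis unfolding Om PAt by (rule a_atLA)
    next
      case (Pos N)
      have "act \<Gamma> (add_mset (N, u) \<Delta>) \<Omega>' R"
      proof (rule sub)
        fix \<Gamma>' D assume e: "ext \<Gamma> \<Gamma>'" and D: "sat pol \<Gamma>' (erase_ctx \<Omega>') D"
        have "sem pol (eraseN N) u \<Gamma>' {#(N, u)#}"
        \<comment> \<open>The share for \<open>Pos N\<close> is the hypothesis \<open>N\<close>
          itself, through \<open>d_lf\<close> and adequacy of \<open>N\<close>. The form excluded by
          \<open>d_lf\<close> is a generator of its positive atom.\<close>
        proof (cases "\<forall>p ts. N \<noteq> Neg (PAtom p ts)")
          case True
          show ?thesis
            by (rule n_adequateD[OF IHn ext_finite[OF e] lfoc_pred_linear[OF True]])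
              (use ok Om Pos in simp_all)
        next
          case False
          then show ?thesis using ok Om Pos by (auto simp: sem_atom_hyp simp del: sem.simps)
        qed
        then have "sem pol (eraseP P) u \<Gamma>' {#(N, u)#}" using Pos by simp
        from H[OF e this D] show "holds pol R \<Gamma>' (add_mset (N, u) \<Delta> + D)" by simp
      qed (use ok fin Om Pos in simp_all)
      then show ?thesis unfolding Om Pos by (rule a_posL)
    qed
  qed
qed

text \<open>Read upwards, each left-focus rule passes \<open>lfoc_pred\<close> from \<open>N\<close>
  to its components, where the induction hypothesis applies. Implication also needs
  \<open>p_adequate\<close> for its argument, and \<open>Neg P\<close>, which ends the focus, needs
  adequacy of the active sequent with \<open>P\<close> in \<Omega>.\<close>

lemma n_adequate_step:
  fixes N :: "('a, 'f, 'c::monoid_mult) nprop"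
  assumes IHa: "\<And>(P :: ('a, 'f, 'c) pprop) u Q w. p_size P < n_size N \<Longrightarrow> polokP pol P \<Longrightarrow> act_adequate pol {#(P, u)#} (RP Q w)"
    and IHn: "\<And>(N' :: ('a, 'f, 'c) nprop) u. n_size N' < n_size N \<Longrightarrow> polokN pol N' \<Longrightarrow> n_adequate pol N' u"
    and IHp: "\<And>(P :: ('a, 'f, 'c) pprop) u. p_size P < n_size N \<Longrightarrow> polokP pol P \<Longrightarrow> p_adequate pol P u"
    and ok: "polokN pol N"
  shows "n_adequate pol N u"
  unfolding n_adequate_def
proof (intro allI impI)
  fix \<Gamma> \<Delta>
  assume fin: "finite \<Gamma>" and F: "lfoc_pred N u \<Gamma> \<Delta>"
  have sub: "sem pol (eraseN N') u' \<Gamma> \<Delta>"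
    if "n_size N' < n_size N" "polokN pol N'"
      and "\<And>\<Gamma>' \<Delta>' Q w. lfoc \<Gamma>' \<Delta>' N' u' Q w \<Longrightarrow> lfoc \<Gamma>' \<Delta>' N u Q w" for N' u'
    by (rule n_adequateD[OF IHn[OF that(1,2)] fin lfoc_pred_weaken[OF F that(3)]])
  show "sem pol (eraseN N) u \<Gamma> \<Delta>"
  proof (cases N)
    case (NAtom a ts)
    have "act \<Gamma>' (\<Delta> + {#}) {#} (RP (Pos (NAtom a ts)) v)" if "ext \<Gamma> \<Gamma>'" "weq u v" for \<Gamma>' v
      by (rule lfoc_predD[OF F that(1)]) (use NAtom f_li[OF that(2)] in simp)
    then show ?thesis using ok NAtom by simp
  next
    case (NWith M1 M2)
    have "sem pol (eraseN M1) u \<Gamma> \<Delta>"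
      by (rule sub; use ok NWith in \<open>simp add: f_withL1\<close>)
    moreover have "sem pol (eraseN M2) u \<Gamma> \<Delta>"
      by (rule sub; use ok NWith in \<open>simp add: f_withL2\<close>)
    ultimately show ?thesis using NWith by simp
  next
    case NTop
    then show ?thesis by simp
  next
    case (NLolli P M)
    have p: "p_adequate pol P u" and n: "n_adequate pol M u"
      by (rule IHp IHn; use ok NLolli in simp)+
    have "sem pol (eraseN M) u \<Gamma>' (D + \<Delta>)" if e: "ext \<Gamma> \<Gamma>'" and D: "sem pol (eraseP P) u \<Gamma>' D" for \<Gamma>' D
    \<comment> \<open>The argument is covered by contexts with a right focus on \<open>P\<close>.
      For such a context \<open>d\<close>, \<multimap>L joins that focus to any left focus on
      \<open>M\<close>, so \<open>d + \<Delta>\<close> can stand in for a focused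
      \<open>M\<close>.\<close>
    proof (rule cl_bind[OF fact_sem ext_finite[OF e] p_adequateD[OF p ext_finite[OF e] D]])
      fix \<Gamma>'' d assume e': "ext \<Gamma>' \<Gamma>''" and d: "rfoc_pred P u \<Gamma>'' d"
      show "sem pol (eraseN M) u \<Gamma>'' (d + \<Delta>)"
      proof (rule n_adequateD[OF n ext_finite[OF e']])
        show "lfoc_pred M u \<Gamma>'' (d + \<Delta>)"
          unfolding lfoc_pred_def
        proof (intro allI impI)
          fix \<Gamma>3 \<Xi> Q w assume e3: "ext \<Gamma>'' \<Gamma>3" and l: "lfoc \<Gamma>3 \<Xi> M u Q w"
          have "rfoc \<Gamma>3 d P u" using d e3 unfolding rfoc_pred_def by blast
          from f_lolliL[OF this l]
          have "act \<Gamma>3 (\<Delta> + (d + \<Xi>)) {#} (RP Q w)"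
            unfolding NLolli[symmetric] by (rule lfoc_predD[OF F ext_trans[OF e ext_trans[OF e' e3]]])
          then show "act \<Gamma>3 (d + \<Delta> + \<Xi>) {#} (RP Q w)" by (simp add: ac_simps)
        qed
      qed
    qed
    then show ?thesis using NLolli by (simp add: lolli_def add.commute)
  next
    case (NAll s M)
    show ?thesis
    proof (cases s)
      case STm
      have "sem pol (eraseN (n_openT 0 t M)) u \<Gamma> \<Delta>" if "tm_lc t" for t
        by (rule sub; use ok NAll STm f_allL_tm[OF that] in \<open>simp add: polok_openT\<close>)
      then show ?thesis using NAll STm by (simp add: erase_openT)
    next
      case SWd
      have "sem pol (eraseN (n_openW 0 v M)) u \<Gamma> \<Delta>" if "w_lc v" for v
        by (rule sub; use ok NAll SWd f_allL_wd[OF that] in \<open>simp add: polok_openW\<close>)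
      then show ?thesis using NAll SWd by (simp add: erase_openW)
    qed
  next
    case (NDown M)
    have "sem pol (eraseN (n_openW 0 u M)) u \<Gamma> \<Delta>"
      by (rule sub; use ok NDown f_downLF in \<open>simp add: polok_openW\<close>)
    then show ?thesis using NDown by (simp add: erase_openW)
  next
    case (NAt M v)
    have "sem pol (eraseN M) v \<Gamma> \<Delta>"
      by (rule sub; use ok NAt f_atLF in simp)
    then show ?thesis using NAt by simp
  next
    case (Neg P)
    have "sem pol (eraseP P) u \<Gamma> \<Delta>"
    proof (rule fact_closed[OF fact_sem fin], rule clI)
      fix \<Gamma>' \<Xi> Q w
      assume e: "ext \<Gamma> \<Gamma>'"
        and k: "\<And>\<Gamma>'' \<Delta>'. ext \<Gamma>' \<Gamma>'' \<Longrightarrow> sem pol (eraseP P) u \<Gamma>'' \<Delta>' \<Longrightarrow> act \<Gamma>'' (\<Delta>' + \<Xi>) {#} (RP Q w)"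
      have a: "act_adequate pol {#(P, u)#} (RP Q w)" by (rule IHa) (use ok Neg in simp_all)
      \<comment> \<open>The test \<open>k\<close> is exactly the semantic assumption that adequacy
        asks of this active sequent; \<open>f_negL\<close> then supplies the left focus consumed by
        \<open>F\<close>.\<close>
      have "act \<Gamma>' \<Xi> {#(P, u)#} (RP Q w)"
        by (rule act_adequateD[OF a ext_finite[OF e]]) (use k in \<open>auto simp: sat_add add.commute\<close>)
      then have "lfoc \<Gamma>' \<Xi> N u Q w" unfolding Neg by (rule f_negL)
      then show "act \<Gamma>' (\<Delta> + \<Xi>) {#} (RP Q w)" by (rule lfoc_predD[OF F e])
    qed
    then show ?thesis using Neg by simp
  qed
qed

text \<open>For a connective interpreted by a closure, binding reduces the claim to a generator, to
  which a right-focus rule applies. \<open>PBang N\<close> and \<open>Pos N\<close> leave the focus,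
  and there adequacy of the active sequent with \<open>N\<close> on the right is used.\<close>

lemma p_adequate_step:
  fixes P :: "('a, 'f, 'c::monoid_mult) pprop"
  assumes IHa: "\<And>(N :: ('a, 'f, 'c) nprop) w. n_size N < p_size P \<Longrightarrow> polokN pol N \<Longrightarrow> act_adequate pol {#} (RN N w)"
    and IHp: "\<And>(P' :: ('a, 'f, 'c) pprop) u. p_size P' < p_size P \<Longrightarrow> polokP pol P' \<Longrightarrow> p_adequate pol P' u"
    and ok: "polokP pol P"
  shows "p_adequate pol P w"
  unfolding p_adequate_def
proof (intro allI impI)
  fix \<Gamma> \<Delta>
  assume fin: "finite \<Gamma>" and S: "sem pol (eraseP P) w \<Gamma> \<Delta>"
  have sub: "cl (rfoc_pred P w) \<Gamma>' \<Delta>'"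
    if "p_size P' < p_size P" "polokP pol P'" "finite \<Gamma>'" "sem pol (eraseP P') w' \<Gamma>' \<Delta>'"
      and "\<And>\<Gamma>' \<Delta>'. rfoc \<Gamma>' \<Delta>' P' w' \<Longrightarrow> rfoc \<Gamma>' \<Delta>' P w" for P' w' \<Gamma>' \<Delta>'
    by (rule rfoc_pred_weaken[OF p_adequateD[OF IHp[OF that(1,2)] that(3,4)] that(3,5)])
  have right: "act \<Gamma>' \<Delta>' {#} (RN N w)"
    if "n_size N < p_size P" "polokN pol N" "finite \<Gamma>'" "sem pol (eraseN N) w \<Gamma>' \<Delta>'"
    for N :: "('a, 'f, 'c) nprop" and \<Gamma>' \<Delta>'
    by (rule act_adequateD[OF IHa[OF that(1,2)] that(3)]) (use that(4) in \<open>auto intro: sem_mono\<close>)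
  have bind: "cl (rfoc_pred P w) \<Gamma> \<Delta>"
    if "cl X \<Gamma> \<Delta>" "\<And>\<Gamma>' \<Delta>'. finite \<Gamma>' \<Longrightarrow> X \<Gamma>' \<Delta>' \<Longrightarrow> cl (rfoc_pred P w) \<Gamma>' \<Delta>'" for X
    by (rule cl_bind0[OF fact_cl fin that(1)]) (rule that(2)[OF ext_finite])
  have unit: "cl (rfoc_pred P w) \<Gamma>' \<Delta>'"
    if "\<And>\<Gamma>''. ext \<Gamma>' \<Gamma>'' \<Longrightarrow> rfoc \<Gamma>'' \<Delta>' P w" for \<Gamma>' \<Delta>'
    unfolding rfoc_pred_def by (rule cl_unit) (use that ext_trans in blast)
  show "cl (rfoc_pred P w) \<Gamma> \<Delta>"
  proof (cases P)
    case (PAtom a ts)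
    then have "cl (\<lambda>\<Gamma> \<Delta>. \<exists>u. weq u w \<and> \<Delta> = {#(Neg (PAtom a ts), u)#}) \<Gamma> \<Delta>" using S ok by simp
    then show ?thesis by (rule bind) (auto simp: PAtom intro!: unit[unfolded PAtom] f_ri)
  next
    case (PTensor P1 P2)
    then have "cl (tensor (sem pol (eraseP P1) w) (sem pol (eraseP P2) w)) \<Gamma> \<Delta>" using S by simp
    then show ?thesis
    proof (rule bind)
      fix \<Gamma>' \<Delta>' assume f: "finite \<Gamma>'" and "tensor (sem pol (eraseP P1) w) (sem pol (eraseP P2) w) \<Gamma>' \<Delta>'"
      then obtain d1 d2 where d: "\<Delta>' = d1 + d2" "sem pol (eraseP P1) w \<Gamma>' d1" "sem pol (eraseP P2) w \<Gamma>' d2"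
        unfolding tensor_def by blast
      have "p_adequate pol P1 w" "p_adequate pol P2 w" by (rule IHp; use ok PTensor in simp)+
      then have c: "cl (rfoc_pred P1 w) \<Gamma>' d1" "cl (rfoc_pred P2 w) \<Gamma>' d2"
        using p_adequateD[OF _ f] d(2,3) by auto
      show "cl (rfoc_pred P w) \<Gamma>' \<Delta>'"
        unfolding d(1)
      proof (rule cl_bind[OF fact_cl f c(1)])
        fix \<Gamma>1 e1 assume x1: "ext \<Gamma>' \<Gamma>1" and e1: "rfoc_pred P1 w \<Gamma>1 e1"
        \<comment> \<open>\<open>cl_bind\<close> acts on the left summand, so the two factors are
          resolved one after the other with the summands exchanged in between.\<close>
        have "cl (rfoc_pred P w) \<Gamma>1 (d2 + e1)"
        proof (rule cl_bind[OF fact_cl ext_finite[OF x1] cl_mono[OF c(2) x1]])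
          fix \<Gamma>2 e2 assume x2: "ext \<Gamma>1 \<Gamma>2" and e2: "rfoc_pred P2 w \<Gamma>2 e2"
          show "cl (rfoc_pred P w) \<Gamma>2 (e2 + e1)"
          proof (rule unit)
            fix \<Gamma>3 assume "ext \<Gamma>2 \<Gamma>3"
            then have "rfoc \<Gamma>3 e1 P1 w" "rfoc \<Gamma>3 e2 P2 w"
              using rfoc_pred_mono[OF e1 x2] e2 unfolding rfoc_pred_def by blast+
            then show "rfoc \<Gamma>3 (e2 + e1) P w"
              unfolding PTensor by (subst add.commute) (rule f_tensorR)
          qed
        qed
        then show "cl (rfoc_pred P w) \<Gamma>1 (e1 + d2)" by (simp add: add.commute)
      qed
    qed
  next
    case POne
    then have "cl (\<lambda>\<Gamma> \<Delta>. \<Delta> = {#}) \<Gamma> \<Delta>" using S by simp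
    then show ?thesis by (rule bind) (auto simp: POne intro!: unit[unfolded POne] f_oneR)
  next
    case (PPlus P1 P2)
    then have "cl (\<lambda>\<Gamma> \<Delta>. sem pol (eraseP P1) w \<Gamma> \<Delta> \<or> sem pol (eraseP P2) w \<Gamma> \<Delta>) \<Gamma> \<Delta>" using S by simp
    then show ?thesis
    proof (rule bind)
      fix \<Gamma>' \<Delta>' assume f: "finite \<Gamma>'" and "sem pol (eraseP P1) w \<Gamma>' \<Delta>' \<or> sem pol (eraseP P2) w \<Gamma>' \<Delta>'"
      from this(2) show "cl (rfoc_pred P w) \<Gamma>' \<Delta>'"
      proof
        assume a: "sem pol (eraseP P1) w \<Gamma>' \<Delta>'"
        show ?thesis by (rule sub[OF _ _ f a]) (use ok PPlus in \<open>auto intro: f_plusR1\<close>)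
      next
        assume a: "sem pol (eraseP P2) w \<Gamma>' \<Delta>'"
        show ?thesis by (rule sub[OF _ _ f a]) (use ok PPlus in \<open>auto intro: f_plusR2\<close>)
      qed
    qed
  next
    case PZero
    then have "cl (\<lambda>\<Gamma> \<Delta>. False) \<Gamma> \<Delta>" using S by simp
    then show ?thesis by (rule bind) simp
  next
    case (PBang N)
    then have "cl (\<lambda>\<Gamma> \<Delta>. \<Delta> = {#} \<and> sem pol (eraseN N) w \<Gamma> {#}) \<Gamma> \<Delta>" using S by simp
    then show ?thesis
    proof (rule bind)
      fix \<Gamma>' and \<Delta>' :: "('a, 'f, 'c) njdg multiset"
      assume s: "\<Delta>' = {#} \<and> sem pol (eraseN N) w \<Gamma>' {#}"
      show "cl (rfoc_pred P w) \<Gamma>' \<Delta>'"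
      proof (rule unit)
        fix \<Gamma>'' assume e: "ext \<Gamma>' \<Gamma>''"
        have "act \<Gamma>'' {#} {#} (RN N w)"
          by (rule right) (use ok PBang ext_finite[OF e] sem_mono[OF _ e] s in auto)
        then show "rfoc \<Gamma>'' \<Delta>' P w" using s unfolding PBang by (auto intro: f_bangR)
      qed
    qed
  next
    case (PEx s P')
    show ?thesis
    proof (cases s)
      case STm
      then have "cl (\<lambda>\<Gamma> \<Delta>. \<exists>t. tm_lc t \<and> sem pol (eraseP (p_openT 0 t P')) w \<Gamma> \<Delta>) \<Gamma> \<Delta>"
        using S PEx by (simp add: erase_openT)
      then show ?thesis
      proof (rule bind)
        fix \<Gamma>' \<Delta>' assume f: "finite \<Gamma>'" and "\<exists>t. tm_lc t \<and> sem pol (eraseP (p_openT 0 t P')) w \<Gamma>' \<Delta>'"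
        then obtain t where "tm_lc t" "sem pol (eraseP (p_openT 0 t P')) w \<Gamma>' \<Delta>'" by blast
        from sub[OF _ _ f this(2)] this(1)
        show "cl (rfoc_pred P w) \<Gamma>' \<Delta>'"
          using ok unfolding PEx STm by (simp add: polok_openT f_exR_tm)
      qed
    next
      case SWd
      then have "cl (\<lambda>\<Gamma> \<Delta>. \<exists>v. w_lc v \<and> sem pol (eraseP (p_openW 0 v P')) w \<Gamma> \<Delta>) \<Gamma> \<Delta>"
        using S PEx by (simp add: erase_openW)
      then show ?thesis
      proof (rule bind)
        fix \<Gamma>' \<Delta>' assume f: "finite \<Gamma>'" and "\<exists>v. w_lc v \<and> sem pol (eraseP (p_openW 0 v P')) w \<Gamma>' \<Delta>'"
        then obtain v where "w_lc v" "sem pol (eraseP (p_openW 0 v P')) w \<Gamma>' \<Delta>'" by blast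
        from sub[OF _ _ f this(2)] this(1)
        show "cl (rfoc_pred P w) \<Gamma>' \<Delta>'"
          using ok unfolding PEx SWd by (simp add: polok_openW f_exR_wd)
      qed
    qed
  next
    case (PDown P')
    have *: "sem pol (eraseP (p_openW 0 w P')) w \<Gamma> \<Delta>" using S PDown by (simp add: erase_openW)
    show ?thesis
      by (rule sub[OF _ _ fin *]) (use ok PDown in \<open>auto simp: polok_openW intro: f_downRF\<close>)
  next
    case (PAt P' v)
    have *: "sem pol (eraseP P') v \<Gamma> \<Delta>" using S PAt by simp
    show ?thesis by (rule sub[OF _ _ fin *]) (use ok PAt in \<open>auto intro: f_atRF\<close>)
  next
    case (Pos N)
    show ?thesis
    proof (rule unit)
      fix \<Gamma>' assume e: "ext \<Gamma> \<Gamma>'"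
      have "act \<Gamma>' \<Delta> {#} (RN N w)"
        by (rule right) (use ok Pos ext_finite[OF e] sem_mono[OF S e] in auto)
      then show "rfoc \<Gamma>' \<Delta> P w" unfolding Pos by (rule f_posR)
    qed
  qed
qed

text \<open>The three statements call one another only at strictly smaller size, so one strong
  induction on a common \<open>n\<close> proves them together.\<close>

lemma adequacy:
  fixes R :: "('a, 'f, 'c::monoid_mult) rhs" and N :: "('a, 'f, 'c) nprop" and P :: "('a, 'f, 'c) pprop"
  shows "(act_size \<Omega> R = n \<longrightarrow> ctx_ok pol \<Omega> \<longrightarrow> rhs_ok pol R \<longrightarrow> act_adequate pol \<Omega> R) \<and>
   (n_size N = n \<longrightarrow> polokN pol N \<longrightarrow> n_adequate pol N u) \<and>
   (p_size P = n \<longrightarrow> polokP pol P \<longrightarrow> p_adequate pol P u)"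
proof (induction n arbitrary: \<Omega> R N P u rule: less_induct)
  case (less n)
  have IHa: "act_size \<Omega> R < n \<Longrightarrow> ctx_ok pol \<Omega> \<Longrightarrow> rhs_ok pol R \<Longrightarrow> act_adequate pol \<Omega> R"
    for \<Omega> and R :: "('a, 'f, 'c) rhs"
    by (rule less.IH[THEN conjunct1, rule_format, OF _ refl])
  have IHn: "n_size N < n \<Longrightarrow> polokN pol N \<Longrightarrow> n_adequate pol N u"
    for N :: "('a, 'f, 'c) nprop" and u
    by (rule less.IH[THEN conjunct2, THEN conjunct1, rule_format, OF _ refl])
  have IHp: "p_size P < n \<Longrightarrow> polokP pol P \<Longrightarrow> p_adequate pol P u"
    for P :: "('a, 'f, 'c) pprop" and u
    by (rule less.IH[THEN conjunct2, THEN conjunct2, rule_format, OF _ refl])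
  show ?case
  proof (intro conjI impI)
    assume *: "act_size \<Omega> R = n" "ctx_ok pol \<Omega>" "rhs_ok pol R"
    show "act_adequate pol \<Omega> R"
      by (rule act_adequate_step[OF _ _ _ *(2,3)]; use *(1) IHa IHn IHp in simp)
  next
    assume *: "n_size N = n" "polokN pol N"
    show "n_adequate pol N u"
      by (rule n_adequate_step[OF _ _ _ *(2)]; use *(1) IHa IHn IHp in simp)
  next
    assume *: "p_size P = n" "polokP pol P"
    show "p_adequate pol P u"
      by (rule p_adequate_step[OF _ _ *(2)]; use *(1) IHa IHp in simp)
  qed
qed

section \<open>Completeness of focusing for arbitrary polarizations\<close>

theorem mainTheorem8:
  fixes pol :: "'a \<Rightarrow> bool"
    and \<Gamma> :: "('a, 'f, 'c::monoid_mult) hjdg set"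
    and \<Delta> :: "('a, 'f, 'c) hjdg multiset"
    and C :: "('a, 'f, 'c) hprop" and w :: "'c wexp"
    and negpol :: "('a, 'f, 'c) hjdg \<Rightarrow> ('a, 'f, 'c) nprop"
    and \<Delta>p :: "('a, 'f, 'c) pjdg multiset"
    and Cn :: "('a, 'f, 'c) nprop"
  assumes "finite \<Gamma>"
    and "useq \<Gamma> \<Delta> C w"
    and "\<forall>(A, u)\<in>\<Gamma>. neg_polarization pol (negpol (A, u)) A"
    and "rel_mset (\<lambda>(A, u) (P, v). v = u \<and> pos_polarization pol P A) \<Delta> \<Delta>p"
    and "neg_polarization pol Cn C"
  shows "act {} {#} (image_mset (\<lambda>(A, u). (PBang (negpol (A, u)), u)) (mset_set \<Gamma>) + \<Delta>p) (RN Cn w)"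
proof -
  let ?\<Omega> = "image_mset (\<lambda>(A, u). (PBang (negpol (A, u)), u)) (mset_set \<Gamma>)"
  have neg: "polokN pol (negpol (A, u)) \<and> eraseN (negpol (A, u)) = A" if "(A, u) \<in> \<Gamma>" for A u
    using assms(3) that unfolding neg_polarization_def by blast
  \<comment> \<open>Erasure commutes with \<open>!\<close> and undoes each polarization chosen by
    \<open>negpol\<close>, so the model sees \<open>!\<Gamma>\<close> itself.\<close>
  have eG: "erase_ctx ?\<Omega> = image_mset (\<lambda>(A, u). (HBang A, u)) (mset_set \<Gamma>)"
    unfolding image_mset.compositionality by (rule image_mset_cong) (use neg assms(1) in auto)
  have D: "erase_ctx \<Delta>p = \<Delta> \<and> ctx_ok pol \<Delta>p"
    using assms(4)
  proof (induction \<Delta> arbitrary: \<Delta>p)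
    case empty
    then show ?case by (metis ctx_ok_simps(1) image_mset_empty rel_mset_size size_eq_0_iff_empty size_empty)
  next
    case (add j \<Delta>)
    from msed_rel_invL[OF add.prems] add.IH show ?case
      by (cases j) (auto simp: pos_polarization_def)
  qed
  have okG: "ctx_ok pol ?\<Omega>"
    unfolding ctx_ok_def using neg assms(1) by auto
  \<comment> \<open>With the whole sequent placed in \<Omega>, it remains to show that every share
    of the erased hypotheses lies in the interpretation of \<open>C\<close>; this is soundness for
    the unfocused derivation.\<close>
  have "act_adequate pol (?\<Omega> + \<Delta>p) (RN Cn w)"
    by (rule adequacy[THEN conjunct1, rule_format, OF refl])
      (use okG D assms(5) in \<open>simp_all add: neg_polarization_def\<close>)
  then show ?thesis
  proof (rule act_adequateD)
    fix \<Gamma>' D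
    assume e: "ext {} \<Gamma>'" and s: "sat pol \<Gamma>' (erase_ctx (?\<Omega> + \<Delta>p)) D"
    have "useq {} (erase_ctx (?\<Omega> + \<Delta>p)) C w"
      using useq_bang[OF assms(1), of "{}" \<Delta> C w] assms(2) eG D by simp
    \<comment> \<open>The identity substitutions have locally closed images and recover the original
      sequent.\<close>
    from soundness[OF this, of TFree WFree pol] have "valid pol TFree WFree {} (erase_ctx (?\<Omega> + \<Delta>p)) C w"
      by simp
    moreover have "valid_persistent pol TFree WFree {} \<Gamma>'"
      using ext_finite[OF e] by (simp add: valid_persistent_def)
    moreover have "image_mset (j_subst TFree WFree) M = M" for M :: "('a, 'f, 'c) hjdg multiset"
      by (induction M) (auto simp: h_subst_free w_subst_WFree)
    ultimately have "sem pol C w \<Gamma>' D"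
      using s validD[of pol TFree WFree "{}" _ C w \<Gamma>' D] by (simp add: h_subst_free w_subst_WFree)
    then show "holds pol (RN Cn w) \<Gamma>' ({#} + D)"
      using assms(5) by (simp add: neg_polarization_def)
  qed simp
qed

end
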